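(* Let $\Phi=(V,\mathscr{C})$ be a hypergraph with $V=[n]$, and suppose there exist a constant $\varepsilon\in(0,1)$ and $\beta>0$ such that $\Pr[\mathscr{B}_L]\le\beta(1-\varepsilon)^L$ for all $L\in\mathbb{N}$. Run the CFTP sampler below with $L:=\left\lceil\frac{\log(2\beta)}{-\log(1-\varepsilon)}\right\rceil$. Then the sampler terminates with probability $1$, has expected running time $O\left(\frac{\log(2\beta)}{-\log(1-\varepsilon)}\cdot\sum_{C\in\mathscr{C}}\sum_{C'\in\mathscr{C}:\,C\cap C'\neq\emptyset}\lvert C'\rvert\,\lvert C\rvert\right)$, and its output is distributed exactly according to the uniform distribution $\mu$ on $\Omega_\Phi$.
   Context: $\Phi=(V,\mathscr{C})$ has vertex set $V=[n]$ and hyperedges $\mathscr{C}$ (nonempty subsets of $V$). A coloring $\sigma\in\{0,1\}^V$ is an independent set if every $C\in\mathscr{C}$ contains some $v$ with $\sigma(v)=0$; $\Omega_\Phi$ is the set of independent sets. $\sigma^{v\gets r}$ is $\sigma$ with the value at $v$ replaced by $r$; $f(\sigma;v,r):=\sigma^{v\gets r}$ if $\sigma^{v\gets r}\in\Omega_\Phi$, else $\sigma$. Scan sequence $v_i:=(i\bmod n)+1$; $F(\sigma;r_1,\dots,r_t):=f(f(\cdots f(\sigma;v_1,r_1)\cdots);v_t,r_t)$. Witness graph: $\mathrm{UpdTime}(v,t):=\max\{t^*\le t:v_{t^*}=v\}$; for $C\in\mathscr{C}$, $e_{C,t}:=\{\mathrm{UpdTime}(v,t):v\in C\}$ with label $C$.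 $H_T$ is the directed graph on $V_T:=\{e_{C,t}:t\in[T],C\in\mathscr{C},v_t\in C\}$ (vertices regarded as pairs $(C,t)$) with an edge $e_{C,t}\to e_{C',t'}$ iff $t'<t$ and $e_{C,t}\cap e_{C',t'}\neq\emptyset$. An induced path of length $\ell$ is a sequence $(e_1,\dots,e_\ell)$ of distinct vertices with $e_i\to e_{i+1}$ an edge for each $i<\ell$ and no other edges of $H_T$ among them. Given values $B_1,\dots,B_T\in\{0,1\}$, a vertex $e$ is open if $B_t=1$ for all $t\in e$. For $T=n(L+1)$, $\mathscr{B}_L$ is the event that $H_T$ contains an open induced path $(e_1,\dots,e_L)$ with $e_1\cap(T-n,T]\neq\emptyset$; in $\Pr[\mathscr{B}_L]$ the $B_t$ are independent $\mathrm{Bern}(1/2)$. CFTP sampler with parameter $L$ and $T:=n(L+1)$: for $j=1,2,\dots$, generate fresh independent $\mathrm{Bern}(1/2)$ variables $R_{-jT+1},\dots,R_{-(j-1)T}$ and decide (Detect step) whether $\mathscr{B}_L$ occurs with $B_1,\dots,B_T$ realized as $R_{-jT+1},\dots,R_{-(j-1)T}$; the Detect step is implemented by, for each intersecting pair $C,C'\in\mathscr{C}$, each $t\in[T]$ with $v_t\in C$ and each $t'\in[t-n,t)$ with $v_{t'}\in C'$, adding the edge $e_{C,t}\to e_{C',t'}$ if the two intersect and are both open, and then running breadth-first search from all $e_{C,t}$ with $t\in(T-n,T]$. Stop at the first $j$ (call it $J$) for which $\mathscr{B}_L$ does not occur, and output $F(\{0\}^V;R_{-JT+1},\dots,R_0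)$.
   Formalization: Proved for β > 1/2 (else L ≤ 0 and the time bound is ≤ 0); the O-constant depends on ε and a lower bound β₀ > 1/2 of β; the double sum gains the number of vertices in no hyperedge (for 𝒞 = ∅ the stated bound is 0); shown for stopping on B_L and on the BFS answer, which can differ. *)

theory Defs
  imports "HOL-Probability.Probability"
begin

subsection \<open>Hypergraph independent sets and the systematic scan\<close>

text \<open>Colours are booleans, with \<open>True\<close> for 1 and \<open>False\<close> for 0. Colourings are extensional
  functions on the vertex set \<open>{1..n}\<close>.\<close>

definition hypergraph :: "nat \<Rightarrow> nat set set \<Rightarrow> bool" where
  "hypergraph n CC \<longleftrightarrow> 0 < n \<and> (\<forall>C\<in>CC. C \<noteq> {} \<and> C \<subseteq> {1..n})"

definition indep_sets :: "nat \<Rightarrow> nat set set \<Rightarrow> (nat \<Rightarrow> bool) set" where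
  "indep_sets n CC = {\<sigma> \<in> {1..n} \<rightarrow>\<^sub>E UNIV. \<forall>C\<in>CC. \<exists>v\<in>C. \<not> \<sigma> v}"

definition update ::
  "nat \<Rightarrow> nat set set \<Rightarrow> (nat \<Rightarrow> bool) \<Rightarrow> nat \<Rightarrow> bool \<Rightarrow> (nat \<Rightarrow> bool)" where
  "update n CC \<sigma> v r = (if \<sigma>(v := r) \<in> indep_sets n CC then \<sigma>(v := r) else \<sigma>)"

definition scan :: "nat \<Rightarrow> int \<Rightarrow> nat" where
  "scan n i = nat (i mod int n) + 1"

text \<open>\<open>run n CC r t \<sigma>\<close> is \<open>F(\<sigma>; r 1, ..., r t)\<close>.\<close>

primrec run ::
  "nat \<Rightarrow> nat set set \<Rightarrow> (nat \<Rightarrow> bool) \<Rightarrow> nat \<Rightarrow> (nat \<Rightarrow> bool) \<Rightarrow> (nat \<Rightarrow> bool)" where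
  "run n CC r 0 \<sigma> = \<sigma>"
| "run n CC r (Suc t) \<sigma> = update n CC (run n CC r t \<sigma>) (scan n (int (Suc t))) (r (Suc t))"


subsection \<open>The witness graph\<close>

definition upd_time :: "nat \<Rightarrow> nat \<Rightarrow> int \<Rightarrow> int" where
  "upd_time n v t = (GREATEST s. s \<le> t \<and> scan n s = v)"

definition stamps :: "nat \<Rightarrow> nat set \<times> int \<Rightarrow> int set" where
  "stamps n = (\<lambda>(C, t). (\<lambda>v. upd_time n v t) ` C)"

definition witness_verts :: "nat \<Rightarrow> nat set set \<Rightarrow> nat \<Rightarrow> (nat set \<times> int) set" where
  "witness_verts n CC T = {(C, t). C \<in> CC \<and> t \<in> {1..int T} \<and> scan n t \<in> C}"

definition witness_edge :: "nat \<Rightarrow> nat set \<times> int \<Rightarrow> nat set \<times> int \<Rightarrow> bool" where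
  "witness_edge n x y \<longleftrightarrow> snd y < snd x \<and> stamps n x \<inter> stamps n y \<noteq> {}"

definition induced_path :: "nat \<Rightarrow> nat set set \<Rightarrow> nat \<Rightarrow> (nat set \<times> int) list \<Rightarrow> bool" where
  "induced_path n CC T p \<longleftrightarrow>
     set p \<subseteq> witness_verts n CC T \<and> distinct p \<and>
     (\<forall>i<length p. \<forall>j<length p. witness_edge n (p ! i) (p ! j) \<longleftrightarrow> j = Suc i)"

definition open_vert :: "nat \<Rightarrow> (int \<Rightarrow> bool) \<Rightarrow> nat set \<times> int \<Rightarrow> bool" where
  "open_vert n B x \<longleftrightarrow> (\<forall>s \<in> stamps n x. B s)"

definition horizon :: "nat \<Rightarrow> nat \<Rightarrow> nat" where
  "horizon n L = n * (L + 1)"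

text \<open>Meaningful for \<open>L \<ge> 1\<close> only.\<close>

definition bad_event :: "nat \<Rightarrow> nat set set \<Rightarrow> nat \<Rightarrow> (int \<Rightarrow> bool) \<Rightarrow> bool" where
  "bad_event n CC L B \<longleftrightarrow>
     (\<exists>p. induced_path n CC (horizon n L) p \<and> length p = L \<and> (\<forall>x \<in> set p. open_vert n B x) \<and>
          stamps n (hd p) \<inter> {int (horizon n L) - int n <.. int (horizon n L)} \<noteq> {})"

text \<open>A vertex \<open>(C, t)\<close> with \<open>t < n\<close> may carry time stamps \<open>\<le> 0\<close>, for which no bit is given;
  such bits are read as 0. This does not affect \<open>bad_event\<close>: consecutive vertices of a path are less
  than \<open>n\<close> time units apart, so that \<open>L\<close> vertices starting in the last \<open>n\<close> of the \<open>n (L + 1)\<close> time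
  units have positive stamps only.\<close>

definition prob_bad :: "nat \<Rightarrow> nat set set \<Rightarrow> nat \<Rightarrow> real" where
  "prob_bad n CC L =
     measure_pmf.prob (Pi_pmf {1..int (horizon n L)} False (\<lambda>_. bernoulli_pmf (1/2)))
       {B. bad_event n CC L B}"


subsection \<open>Programs with step counts\<close>

text \<open>A program returns its result together with the number of elementary steps of a unit-cost
  random access machine, up to constant factors. A loop charges one step per iteration, which pays
  for the constant-time part of its body; everything else is charged by the body. Tables indexed by
  vertices, hyperedges or pairs of a hyperedge and a time are modelled as functions; reading and
  updating them, testing membership by marks, and computing \<open>scan\<close> and \<open>upd_time\<close> take constant
  time.\<close>

type_synonym 'a timed = "'a \<times> nat"

primrec for_each :: "'a list \<Rightarrow> ('a \<Rightarrow> 's \<Rightarrow> 's timed) \<Rightarrow> 's \<Rightarrow> 's timed" where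
  "for_each [] f s = (s, 0)"
| "for_each (x # xs) f s =
     (let (s', c) = f x s; (s'', d) = for_each xs f s' in (s'', 1 + c + d))"

definition elems :: "nat set \<Rightarrow> nat list" where
  "elems C = sorted_list_of_set C"

definition slots :: "nat \<Rightarrow> nat set \<Rightarrow> int \<Rightarrow> int \<Rightarrow> int list" where
  "slots n C a b = sorted_list_of_set {t \<in> {a..b}. scan n t \<in> C}"

text \<open>The hyperedges are supplied as a list \<open>Es\<close>. The incidence table lists the hyperedges through
  each vertex; the neighbour table lists, for each hyperedge, the hyperedges that meet it.\<close>

definition incidence :: "nat set list \<Rightarrow> (nat \<Rightarrow> nat set list) timed" where
  "incidence Es =
     for_each Es (\<lambda>C. for_each (elems C) (\<lambda>v inc. (inc(v := C # inc v), 0))) (\<lambda>_. [])"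

definition neighbours ::
  "nat set list \<Rightarrow> (nat \<Rightarrow> nat set list) \<Rightarrow> (nat set \<Rightarrow> nat set list) timed" where
  "neighbours Es inc =
     for_each Es
       (\<lambda>C nb. let (xs, c) =
           for_each (elems C)
             (\<lambda>v. for_each (inc v) (\<lambda>C' xs. (if C' \<in> set xs then xs else C' # xs, 0))) []
         in (nb(C := xs), c))
       (\<lambda>_. [])"

definition open_table ::
  "nat \<Rightarrow> nat set list \<Rightarrow> nat \<Rightarrow> (int \<Rightarrow> bool) \<Rightarrow> (nat set \<times> int \<Rightarrow> bool) timed" where
  "open_table n Es T B =
     for_each Es
       (\<lambda>C. for_each (slots n C 1 (int T))
         (\<lambda>t tab. (tab((C, t) := open_vert n B (C, t)), card C)))
       (\<lambda>_. False)"

text \<open>For \<open>t' < t\<close>, the stamps of \<open>(C, t)\<close> and \<open>(C', t')\<close> meet iff the minimum of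
  \<open>upd_time n v t\<close> over \<open>v \<in> C \<inter> C'\<close> is at most \<open>t'\<close>. The term \<open>card C'\<close> pays for computing this
  minimum once for \<open>C\<close>, \<open>C'\<close> and \<open>t\<close>, after which the test takes constant time for each \<open>t'\<close>.\<close>

definition edge_table ::
  "nat \<Rightarrow> nat set list \<Rightarrow> (nat set \<Rightarrow> nat set list) \<Rightarrow> nat \<Rightarrow> (nat set \<times> int \<Rightarrow> bool) \<Rightarrow>
   (nat set \<times> int \<Rightarrow> (nat set \<times> int) list) timed" where
  "edge_table n Es nb T opn =
     for_each Es
       (\<lambda>C. for_each (nb C)
         (\<lambda>C'. for_each (slots n C 1 (int T))
           (\<lambda>t adj. let (adj', c) =
               for_each (slots n C' (t - int n) (t - 1))
                 (\<lambda>t' adj.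
                   (if stamps n (C, t) \<inter> stamps n (C', t') \<noteq> {} \<and> opn (C, t) \<and> opn (C', t')
                    then adj((C, t) := (C', t') # adj (C, t)) else adj, 0))
                 adj
             in (adj', card C' + c))))
       (\<lambda>_. [])"

definition roots ::
  "nat \<Rightarrow> nat set list \<Rightarrow> nat \<Rightarrow> (nat set \<times> int \<Rightarrow> bool) \<Rightarrow> (nat set \<times> int) list timed" where
  "roots n Es T opn =
     for_each Es
       (\<lambda>C. for_each (slots n C (int T - int n + 1) (int T))
         (\<lambda>t q. (if opn (C, t) then (C, t) # q else q, 0)))
       []"

text \<open>\<open>bfs adj k vis q\<close> explores \<open>k\<close> further levels, starting from the current level \<open>q\<close> and the
  set \<open>vis\<close> of vertices seen so far, and returns the last level.\<close>

primrec bfs :: "('v \<Rightarrow> 'v list) \<Rightarrow> nat \<Rightarrow> 'v set \<Rightarrow> 'v list \<Rightarrow> 'v list timed" where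
  "bfs adj 0 vis q = (q, 0)"
| "bfs adj (Suc k) vis q =
     (let ((vis', q'), c) =
            for_each q
              (\<lambda>x. for_each (adj x)
                (\<lambda>y (vis, q). (if y \<in> vis then (vis, q) else (insert y vis, y # q), 0)))
              (vis, []);
          (res, d) = bfs adj k vis' q'
      in (res, 1 + c + d))"

text \<open>The answer is whether some vertex has breadth-first distance \<open>L - 1\<close> from the set of roots,
  i.e. whether the search tree has a branch of \<open>L\<close> vertices. Such a branch is an open induced path,
  but \<open>bad_event\<close> may also occur without one.\<close>

definition detect ::
  "nat \<Rightarrow> nat set list \<Rightarrow> (nat set \<Rightarrow> nat set list) \<Rightarrow> nat \<Rightarrow> (int \<Rightarrow> bool) \<Rightarrow> bool timed" where
  "detect n Es nb L B =
     (let T = horizon n L;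
          (opn, c1) = open_table n Es T B;
          (adj, c2) = edge_table n Es nb T opn;
          (q, c3) = roots n Es T opn;
          (res, c4) = bfs adj (L - 1) (set q) q
      in (res \<noteq> [], c1 + c2 + c3 + c4))"

definition detect_answer :: "nat \<Rightarrow> nat set list \<Rightarrow> nat \<Rightarrow> (int \<Rightarrow> bool) \<Rightarrow> bool" where
  "detect_answer n Es L B = fst (detect n Es (fst (neighbours Es (fst (incidence Es)))) L B)"

text \<open>From an independent set, deciding whether the updated colouring is independent only requires
  inspecting the hyperedges through the updated vertex.\<close>

definition run_timed ::
  "nat \<Rightarrow> nat set set \<Rightarrow> (nat \<Rightarrow> nat set list) \<Rightarrow> (nat \<Rightarrow> bool) \<Rightarrow> nat \<Rightarrow> (nat \<Rightarrow> bool) \<Rightarrow>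
   (nat \<Rightarrow> bool) timed" where
  "run_timed n CC inc r t =
     for_each [1..<Suc t]
       (\<lambda>i \<sigma>. (update n CC \<sigma> (scan n (int i)) (r i), \<Sum>C\<leftarrow>inc (scan n (int i)). 1 + card C))"


subsection \<open>The sampler\<close>

definition fair_bits :: "(int \<Rightarrow> bool) measure" where
  "fair_bits = Pi\<^sub>M {..0} (\<lambda>_. measure_pmf (bernoulli_pmf (1/2)))"

definition block :: "nat \<Rightarrow> nat \<Rightarrow> (int \<Rightarrow> bool) \<Rightarrow> int \<Rightarrow> bool" where
  "block T j R t \<longleftrightarrow> t \<in> {1..int T} \<and> R (t - int (j * T))"

text \<open>The argument \<open>occ\<close> is the decision rule of the Detect step, applied to the bits of a round.\<close>

definition stops_at ::
  "nat \<Rightarrow> nat \<Rightarrow> ((int \<Rightarrow> bool) \<Rightarrow> bool) \<Rightarrow> (int \<Rightarrow> bool) \<Rightarrow> nat \<Rightarrow> bool" where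
  "stops_at n L occ R j \<longleftrightarrow> 1 \<le> j \<and> \<not> occ (block (horizon n L) j R)"

definition cftp_halts ::
  "nat \<Rightarrow> nat \<Rightarrow> ((int \<Rightarrow> bool) \<Rightarrow> bool) \<Rightarrow> (int \<Rightarrow> bool) \<Rightarrow> bool" where
  "cftp_halts n L occ R \<longleftrightarrow> (\<exists>j. stops_at n L occ R j)"

definition cftp_rounds ::
  "nat \<Rightarrow> nat \<Rightarrow> ((int \<Rightarrow> bool) \<Rightarrow> bool) \<Rightarrow> (int \<Rightarrow> bool) \<Rightarrow> nat" where
  "cftp_rounds n L occ R = (LEAST j. stops_at n L occ R j)"

definition all_zero :: "nat \<Rightarrow> nat \<Rightarrow> bool" where
  "all_zero n = (\<lambda>v\<in>{1..n}. False)"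

definition cftp_output ::
  "nat \<Rightarrow> nat set set \<Rightarrow> nat \<Rightarrow> ((int \<Rightarrow> bool) \<Rightarrow> bool) \<Rightarrow> (int \<Rightarrow> bool) \<Rightarrow> (nat \<Rightarrow> bool)" where
  "cftp_output n CC L occ R =
     (let t = cftp_rounds n L occ R * horizon n L
      in run n CC (\<lambda>i. R (int i - int t)) t (all_zero n))"

text \<open>The running time consists of building the incidence and neighbour tables, of drawing the
  bits and running \<open>detect\<close> in each round, and of the final evaluation.\<close>

definition cftp_time ::
  "nat \<Rightarrow> nat set list \<Rightarrow> nat \<Rightarrow> ((int \<Rightarrow> bool) \<Rightarrow> bool) \<Rightarrow> (int \<Rightarrow> bool) \<Rightarrow> ennreal" where
  "cftp_time n Es L occ R =
     (if cftp_halts n L occ R then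
        (let T = horizon n L;
             J = cftp_rounds n L occ R;
             (inc, c1) = incidence Es;
             (nb, c2) = neighbours Es inc;
             c3 = (\<Sum>j=1..J. T + snd (detect n Es nb L (block T j R)));
             c4 = snd (run_timed n (set Es) inc (\<lambda>i. R (int i - int (J * T))) (J * T) (all_zero n))
         in of_nat (c1 + c2 + c3 + c4))
      else \<infinity>)"

end

theory Submission
  imports Defs
begin

text \<open>
  Run two copies of the scan with the same bits from different independent sets. A vertex on which
  they disagree was last updated with bit 1, and one copy rejected this update because of a
  hyperedge on which it is otherwise constantly 1; this hyperedge and the update time form an open
  vertex of the witness graph, and the other copy disagrees on the hyperedge at an earlier time.
  Following disagreements back in time gives an open path from the last \<open>n\<close> time units down to time
  below \<open>2 * n\<close>. As an edge bridges less than \<open>n\<close> time units, the breadth-first distance to its end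
  is at least \<open>L - 1\<close>, so the search finds a vertex at distance exactly \<open>L - 1\<close>. A shortest path to
  that vertex is induced, which is why both decision rules lie between non-coalescence and the bad
  event; in particular a round fails with probability at most \<open>1/2\<close>.

  Rounds are independent, so their number is dominated by a geometric variable of mean 2, and each
  round costs a constant times \<open>L + 1\<close> times the size of the instance. For the output, the uniform
  distribution is stationary for every single update. Hence running \<open>m\<close> rounds from a uniform start
  is exactly uniform, and it agrees with the output unless the first \<open>m\<close> rounds all fail, which has
  probability at most \<open>2 ^ - m\<close>.
\<close>

subsection \<open>Update times and stamps\<close>

lemma scan_in: "0 < n \<Longrightarrow> scan n t \<in> {1..n}"
  unfolding scan_def by (auto simp: Suc_le_eq nat_less_iff)

lemma scan_eq_iff:
  assumes "0 < n"
  shows "scan n s = scan n t \<longleftrightarrow> int n dvd s - t"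
proof -
  have "scan n s = scan n t \<longleftrightarrow> s mod int n = t mod int n"
    using assms by (simp add: scan_def eq_nat_nat_iff)
  thus ?thesis by (simp add: mod_eq_dvd_iff)
qed

text \<open>Times with equal \<open>scan\<close> differ by a multiple of \<open>n\<close>, so a
  window of \<open>n\<close> consecutive times visits a vertex only once.\<close>

lemma upd_time_unique:
  assumes n: "0 < n" and s: "t - int n < s" "s \<le> t" "scan n s = v"
  shows "upd_time n v t = s"
  unfolding upd_time_def
proof (rule Greatest_equality)
  show "s \<le> t \<and> scan n s = v" using s by simp
  fix y assume y: "y \<le> t \<and> scan n y = v"
  show "y \<le> s"
  proof (rule ccontr)
    assume "\<not> y \<le> s"
    moreover have "int n dvd y - s" using y s scan_eq_iff[OF n] by metis
    ultimately show False using zdvd_imp_le[of "int n" "y - s"] y s by linarith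
  qed
qed

lemma upd_time_props:
  assumes n: "0 < n" and v: "v \<in> {1..n}"
  shows "t - int n < upd_time n v t" "upd_time n v t \<le> t" "scan n (upd_time n v t) = v"
proof -
  \<comment> \<open>The largest time up to \<open>t\<close> that is congruent to
    \<open>v - 1\<close> modulo \<open>n\<close>; vertices are numbered from 1, hence the
    shift.\<close>
  define s where "s = t - (t - (int v - 1)) mod int n"
  have "scan n s = v"
  proof -
    have "s mod int n = (t - (t - (int v - 1))) mod int n" unfolding s_def by (simp add: mod_simps)
    also have "\<dots> = int v - 1" using v by auto
    finally show ?thesis using v by (auto simp: scan_def)
  qed
  moreover have "t - int n < s" "s \<le> t" using n by (auto simp: s_def)
  ultimately show "t - int n < upd_time n v t" "upd_time n v t \<le> t" "scan n (upd_time n v t) = v"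
    using upd_time_unique[OF n] by simp_all
qed

lemma upd_time_eq:
  assumes n: "0 < n" and v: "v \<in> {1..n}" and s: "upd_time n v t \<le> s" "s \<le> t"
  shows "upd_time n v s = upd_time n v t"
  using upd_time_props[OF n v, of t] s by (intro upd_time_unique[OF n]) auto

lemma stamps_window:
  assumes "hypergraph n CC" "C \<in> CC" "s \<in> stamps n (C, t)"
  shows "t - int n < s" "s \<le> t" "scan n s \<in> C"
  using assms upd_time_props[of n _ t] unfolding hypergraph_def stamps_def
  by (auto simp: subset_iff)

lemma self_in_stamps:
  assumes "0 < n" "scan n t \<in> C"
  shows "t \<in> stamps n (C, t)"
proof -
  have "upd_time n (scan n t) t = t" using assms by (intro upd_time_unique) auto
  thus ?thesis using assms by (auto simp: stamps_def image_iff intro!: bexI[of _ "scan n t"])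
qed

text \<open>A common stamp \<open>s\<close> satisfies \<open>t - n < s\<close> by the window of the
  first vertex and \<open>s\<close> \<le> \<open>t'\<close> by that of the second, and the vertex
  scanned at \<open>s\<close> lies in both hyperedges. This is why it suffices to search the last
  \<open>n\<close> times and the intersecting hyperedges.\<close>

lemma witness_edgeD:
  assumes "hypergraph n CC" "C \<in> CC" "C' \<in> CC" "witness_edge n (C, t) (C', t')"
  shows "t' < t" "t - int n < t'" "C \<inter> C' \<noteq> {}"
  using assms stamps_window[OF assms(1,2), of _ t] stamps_window[OF assms(1,3), of _ t']
  unfolding witness_edge_def by (force)+

lemma finite_edges: "hypergraph n CC \<Longrightarrow> C \<in> CC \<Longrightarrow> finite C"
  unfolding hypergraph_def by (meson finite_atLeastAtMost finite_subset)

text \<open>Such a window has at most \<open>n\<close> times, so each of its slots is the update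
  time, as seen from \<open>b\<close>, of the vertex scanned there.\<close>

lemma slots_window_card:
  assumes n: "0 < n" and "finite C" "b < a + int n"
  shows "card {t \<in> {a..b}. scan n t \<in> C} \<le> card C"
proof -
  have "{t \<in> {a..b}. scan n t \<in> C} \<subseteq> (\<lambda>v. upd_time n v b) ` C"
  proof
    fix t assume t: "t \<in> {t \<in> {a..b}. scan n t \<in> C}"
    hence "upd_time n (scan n t) b = t" using assms by (intro upd_time_unique) auto
    thus "t \<in> (\<lambda>v. upd_time n v b) ` C" using t by (auto simp: image_iff intro!: bexI[of _ "scan n t"])
  qed
  thus ?thesis using \<open>finite C\<close> by (meson card_image_le card_mono finite_imageI le_trans)
qed

lemma slots_prefix_card:
  assumes n: "0 < n" and "finite C"
  shows "card {t \<in> {1..int (n * k)}. scan n t \<in> C} \<le> k * card C"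
proof (induction k)
  case (Suc k)
  have "{t \<in> {1..int (n * Suc k)}. scan n t \<in> C} =
     {t \<in> {1..int (n * k)}. scan n t \<in> C} \<union> {t \<in> {int (n * k) + 1..int (n * Suc k)}. scan n t \<in> C}"
    by (auto simp: algebra_simps intro: order_trans[of 1 "1 + int k * int n"])
  hence "card {t \<in> {1..int (n * Suc k)}. scan n t \<in> C} \<le>
     card {t \<in> {1..int (n * k)}. scan n t \<in> C} +
     card {t \<in> {int (n * k) + 1..int (n * Suc k)}. scan n t \<in> C}"
    by (simp add: card_Un_le)
  also have "\<dots> \<le> k * card C + card C"
    using Suc by (intro add_mono slots_window_card assms) auto
  finally show ?case by simp
qed auto

lemma set_slots: "set (slots n C a b) = {t \<in> {a..b}. scan n t \<in> C}"
proof -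
  have "finite {t \<in> {a..b}. scan n t \<in> C}" by (rule finite_subset[of _ "{a..b}"]) auto
  thus ?thesis unfolding slots_def by (rule set_sorted_list_of_set)
qed

lemma length_slots: "length (slots n C a b) = card {t \<in> {a..b}. scan n t \<in> C}"
  by (simp add: slots_def)

lemma distinct_slots: "distinct (slots n C a b)"
  by (simp add: slots_def)

subsection \<open>Tables computed by the programs\<close>

lemma fst_for_each: "fst (for_each xs f s) = fold (\<lambda>x s. fst (f x s)) xs s"
  by (induction xs arbitrary: s) (auto simp: case_prod_beta Let_def)

text \<open>The cost of the body may not depend on the state. All loops of the sampler are of this
  kind, so their costs become plain sums.\<close>

lemma snd_for_each:
  assumes "\<And>x s. x \<in> set xs \<Longrightarrow> snd (f x s) = c x"
  shows "snd (for_each xs f s) = (\<Sum>x\<leftarrow>xs. 1 + c x)"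
  using assms by (induction xs arbitrary: s) (auto simp: case_prod_beta Let_def)

text \<open>Flattens nested loops, so that a single induction over the list of all innermost
  iterations suffices.\<close>

lemma fold_concat_map: "fold (\<lambda>x. fold f (g x)) xs = fold f (concat (map g xs))"
  by (induction xs) (auto simp: fun_eq_iff)

lemma length_concat_map: "length (concat (map g xs)) = (\<Sum>x\<leftarrow>xs. length (g x))"
  by (simp add: length_concat comp_def)

lemma incidence_eq:
  assumes "\<And>C. C \<in> set Es \<Longrightarrow> finite C"
  shows "fst (incidence Es) = (\<lambda>v. rev (filter ((\<in>) v) Es))"
proof -
  have inner: "fold (\<lambda>v inc. inc(v := C # inc v)) xs inc = (\<lambda>v. if v \<in> set xs then C # inc v else inc v)"
    if "distinct xs" for C and xs :: "nat list" and inc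
    using that by (induction xs arbitrary: inc) (auto simp: fun_eq_iff)
  have *: "fold (\<lambda>C. fold (\<lambda>v inc. inc(v := C # inc v)) (elems C)) Es inc
        = (\<lambda>v. rev (filter ((\<in>) v) Es) @ inc v)" for inc
    using assms by (induction Es arbitrary: inc) (auto simp: inner elems_def fun_eq_iff)
  thus ?thesis by (simp add: incidence_def fst_for_each)
qed

lemma incidence_cost: "snd (incidence Es) = (\<Sum>C\<leftarrow>Es. 1 + card C)"
  unfolding incidence_def
  by (subst snd_for_each[where c = card]) (auto simp: snd_for_each[where c = "\<lambda>_. 0"] elems_def sum_list_triv)

lemma fst_neighbours:
  "fst (neighbours Es inc) =
     (\<lambda>C. if C \<in> set Es then fold List.insert (concat (map inc (elems C))) [] else [])"
proof -
  have *: "fold (\<lambda>C nb. nb(C := g C)) Es nb = (\<lambda>C. if C \<in> set Es then g C else nb C)"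
    for g :: "nat set \<Rightarrow> nat set list" and nb
    by (induction Es arbitrary: nb) (auto simp: fun_eq_iff)
  have ins: "(\<lambda>C' xs. if C' \<in> set xs then xs else C' # xs) = List.insert"
    by (auto simp: fun_eq_iff List.insert_def)
  show ?thesis
    unfolding neighbours_def
    by (simp add: fst_for_each case_prod_beta Let_def * ins fold_concat_map)
qed

lemma set_fold_insert: "set (fold List.insert ys xs) = set ys \<union> set xs"
  by (induction ys arbitrary: xs) auto

lemma distinct_fold_insert: "distinct xs \<Longrightarrow> distinct (fold List.insert ys xs)"
  by (induction ys arbitrary: xs) auto

lemma neighbours_props:
  assumes "\<And>C. C \<in> set Es \<Longrightarrow> finite C" "C \<in> set Es"
  defines "nb \<equiv> fst (neighbours Es (fst (incidence Es)))"
  shows "set (nb C) = {C' \<in> set Es. C \<inter> C' \<noteq> {}}" "distinct (nb C)"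
  using assms unfolding nb_def
  by (auto simp: fst_neighbours incidence_eq set_fold_insert elems_def distinct_fold_insert)

lemma neighbours_cost:
  "snd (neighbours Es inc) = (\<Sum>C\<leftarrow>Es. 1 + (\<Sum>v\<leftarrow>elems C. 1 + length (inc v)))"
  unfolding neighbours_def
  by (subst snd_for_each[where c = "\<lambda>C. \<Sum>v\<leftarrow>elems C. 1 + length (inc v)"])
     (auto simp: case_prod_beta Let_def snd_for_each[where c = "\<lambda>_. 0"]
        snd_for_each[where c = "\<lambda>v. length (inc v)"] sum_list_triv)

text \<open>Entries that are never written keep the default \<open>False\<close>, which is how
  membership in \<open>witness_verts\<close> enters.\<close>

lemma open_table_eq:
  "fst (open_table n Es T B) x \<longleftrightarrow> x \<in> witness_verts n (set Es) T \<and> open_vert n B x"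
proof -
  have inner: "fold (\<lambda>t tab. tab((C, t) := open_vert n B (C, t))) ts tab =
     (\<lambda>x. if fst x = C \<and> snd x \<in> set ts then open_vert n B x else tab x)" for C ts tab
    by (induction ts arbitrary: tab) (auto simp: fun_eq_iff)
  have "fold (\<lambda>C. fold (\<lambda>t tab. tab((C, t) := open_vert n B (C, t))) (slots n C 1 (int T))) Es tab
     = (\<lambda>x. if fst x \<in> set Es \<and> snd x \<in> set (slots n (fst x) 1 (int T)) then open_vert n B x else tab x)" for tab
    by (induction Es arbitrary: tab) (auto simp: fun_eq_iff inner)
  thus ?thesis
    by (cases x) (auto simp: open_table_def fst_for_each witness_verts_def set_slots)
qed

lemma open_table_cost:
  "snd (open_table n Es T B) = (\<Sum>C\<leftarrow>Es. 1 + length (slots n C 1 (int T)) * (1 + card C))"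
  unfolding open_table_def
  by (subst snd_for_each[where c = "\<lambda>C. length (slots n C 1 (int T)) * (1 + card C)"])
     (auto simp: snd_for_each[where c = "\<lambda>_. card _"] sum_list_triv)

text \<open>The pairs examined by the loops of \<open>edge_table\<close>, in order. Each test adds
  at most one entry to an adjacency list, so the length of this list also bounds the work of the
  search.\<close>

definition edge_tests ::
  "nat \<Rightarrow> nat set list \<Rightarrow> (nat set \<Rightarrow> nat set list) \<Rightarrow> nat \<Rightarrow> ((nat set \<times> int) \<times> (nat set \<times> int)) list" where
  "edge_tests n Es nb T =
     concat (map (\<lambda>C. concat (map (\<lambda>C'. concat (map (\<lambda>t. map (\<lambda>t'. ((C, t), (C', t')))
       (slots n C' (t - int n) (t - 1))) (slots n C 1 (int T)))) (nb C))) Es)"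

lemma fold_map_apply: "fold f (map g xs) = fold (\<lambda>x. f (g x)) xs"
  by (induction xs) auto

lemma edge_table_eq:
  "fst (edge_table n Es nb T opn) =
     (\<lambda>x. rev (map snd (filter (\<lambda>z. fst z = x \<and> stamps n (fst z) \<inter> stamps n (snd z) \<noteq> {} \<and>
        opn (fst z) \<and> opn (snd z)) (edge_tests n Es nb T))))"
proof -
  define g where "g = (\<lambda>z (adj :: nat set \<times> int \<Rightarrow> (nat set \<times> int) list).
    if stamps n (fst z) \<inter> stamps n (snd z) \<noteq> {} \<and> opn (fst z) \<and> opn (snd z)
    then adj(fst z := snd z # adj (fst z)) else adj)"
  have *: "fold g zs adj = (\<lambda>x. rev (map snd (filter (\<lambda>z. fst z = x \<and>
      stamps n (fst z) \<inter> stamps n (snd z) \<noteq> {} \<and> opn (fst z) \<and> opn (snd z)) zs)) @ adj x)" for zs adj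
    by (induction zs arbitrary: adj) (auto simp: fun_eq_iff g_def)
  have "fst (edge_table n Es nb T opn) = fold g (edge_tests n Es nb T) (\<lambda>_. [])"
    unfolding edge_table_def edge_tests_def
    by (simp add: fst_for_each case_prod_beta Let_def fold_map_apply flip: fold_concat_map)
       (simp add: g_def cong: if_cong)
  thus ?thesis by (simp add: *)
qed

lemma edge_table_cost:
  "snd (edge_table n Es nb T opn) =
     (\<Sum>C\<leftarrow>Es. 1 + (\<Sum>C'\<leftarrow>nb C. 1 + (\<Sum>t\<leftarrow>slots n C 1 (int T).
        1 + (card C' + length (slots n C' (t - int n) (t - 1))))))"
  unfolding edge_table_def
  by (intro snd_for_each) (auto simp: case_prod_beta Let_def intro!: snd_for_each
      simp: snd_for_each[where c = "\<lambda>_. 0"] sum_list_triv)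

lemma set_roots:
  "set (fst (roots n Es T opn)) =
     {(C, t). C \<in> set Es \<and> t \<in> {int T - int n + 1..int T} \<and> scan n t \<in> C \<and> opn (C, t)}"
proof -
  have inner: "set (fold (\<lambda>t q. if opn (C, t) then (C, t) # q else q) ts q) =
      set q \<union> {(C, t) | t. t \<in> set ts \<and> opn (C, t)}" for C ts q
    by (induction ts arbitrary: q) auto
  have "set (fold (\<lambda>C. fold (\<lambda>t q. if opn (C, t) then (C, t) # q else q) (slots n C a b)) Es q) =
      set q \<union> {(C, t). C \<in> set Es \<and> t \<in> set (slots n C a b) \<and> opn (C, t)}" for a b q
    by (induction Es arbitrary: q) (auto simp: inner)
  thus ?thesis by (auto simp: roots_def fst_for_each set_slots)
qed

text \<open>The cost bound of the search charges every queued vertex once and thus starts from a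
  queue without repetitions.\<close>

lemma distinct_roots:
  assumes "distinct Es"
  shows "distinct (fst (roots n Es T opn))"
proof -
  define zs where "zs = concat (map (\<lambda>C. map (Pair C) (slots n C (int T - int n + 1) (int T))) Es)"
  have *: "fold (\<lambda>z q. if opn z then z # q else q) zs q = rev (filter opn zs) @ q" for zs q
    by (induction zs arbitrary: q) auto
  have "fst (roots n Es T opn) = fold (\<lambda>z q. if opn z then z # q else q) zs []"
    unfolding roots_def zs_def
    by (simp add: fst_for_each fold_map_apply flip: fold_concat_map)
  moreover have "distinct zs"
    using assms unfolding zs_def
    by (induction Es) (auto simp: distinct_map inj_on_def distinct_slots)
  ultimately show ?thesis by (simp add: *)
qed

lemma roots_cost:
  "snd (roots n Es T opn) = (\<Sum>C\<leftarrow>Es. 1 + length (slots n C (int T - int n + 1) (int T)))"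
  unfolding roots_def
  by (intro snd_for_each) (auto simp: snd_for_each[where c = "\<lambda>_. 0"] sum_list_triv)

subsection \<open>Breadth-first search\<close>

definition succs :: "('v \<Rightarrow> 'v list) \<Rightarrow> 'v rel" where
  "succs adj = {(x, y). y \<in> set (adj x)}"

text \<open>The vertices at distance exactly \<open>k\<close> from \<open>Q\<close>, i.e. a level of
  the breadth-first search.\<close>

definition layer :: "'v rel \<Rightarrow> 'v set \<Rightarrow> nat \<Rightarrow> 'v set" where
  "layer E Q k = (E ^^ k) `` Q - (\<Union>i<k. (E ^^ i) `` Q)"

definition visit :: "'v \<Rightarrow> 'v set \<times> 'v list \<Rightarrow> 'v set \<times> 'v list" where
  "visit y = (\<lambda>(vis, q). if y \<in> vis then (vis, q) else (insert y vis, y # q))"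

text \<open>A vertex is marked at the moment it is queued. Hence \<open>set q\<close> \<subseteq>
  \<open>vis\<close> is preserved, and no vertex is queued twice.\<close>

lemma fold_visit:
  assumes "fold visit ys (vis, q) = (vis', q')"
  shows "vis' = vis \<union> set ys" "set q' = set q \<union> (set ys - vis)"
    "distinct q \<Longrightarrow> set q \<subseteq> vis \<Longrightarrow> distinct q'"
proof -
  have "vis' = vis \<union> set ys \<and> set q' = set q \<union> (set ys - vis) \<and>
    (distinct q \<longrightarrow> set q \<subseteq> vis \<longrightarrow> distinct q')"
    using assms
    by (induction ys arbitrary: vis q) (fastforce simp: visit_def split: if_splits)+
  thus "vis' = vis \<union> set ys" "set q' = set q \<union> (set ys - vis)"
    "distinct q \<Longrightarrow> set q \<subseteq> vis \<Longrightarrow> distinct q'" by auto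
qed

text \<open>One level of the search, isolated so that the proofs of correctness and of the cost
  bound can share it.\<close>

lemma bfs_Suc:
  fixes q :: "'v list"
  obtains vis' q' where
    "bfs adj (Suc k) vis q = (fst (bfs adj k vis' q'),
        1 + (\<Sum>x\<leftarrow>q. 1 + length (adj x)) + snd (bfs adj k vis' q'))"
    "vis' = vis \<union> succs adj `` set q" "set q' = succs adj `` set q - vis" "distinct q'"
proof -
  define r where "r = for_each q (\<lambda>x. for_each (adj x) (\<lambda>y s. (visit y s, 0))) (vis, [])"
  have r: "fst r = fold visit (concat (map adj q)) (vis, [])"
    by (simp add: r_def fst_for_each fold_concat_map)
  have c: "snd r = (\<Sum>x\<leftarrow>q. 1 + length (adj x))"
    unfolding r_def by (intro snd_for_each) (simp add: snd_for_each[where c = "\<lambda>_. 0"] sum_list_triv)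
  obtain vis' q' where v: "fst r = (vis', q')" by (cases "fst r")
  have succs: "succs adj `` set q = set (concat (map adj q))" by (auto simp: succs_def)
  have "(\<lambda>(y::'v) (vis, q). (if y \<in> vis then (vis, q) else (insert y vis, y # q), 0)) =
    (\<lambda>y s. (visit y s, 0::nat))"
    by (auto simp: visit_def fun_eq_iff)
  hence "for_each q (\<lambda>x. for_each (adj x) (\<lambda>y (vis, q).
      (if y \<in> vis then (vis, q) else (insert y vis, y # q), 0))) (vis, []) = r"
    unfolding r_def by simp
  hence "bfs adj (Suc k) vis q = (fst (bfs adj k vis' q'), 1 + snd r + snd (bfs adj k vis' q'))"
    unfolding bfs.simps using v by (cases r) (simp add: case_prod_unfold Let_def)
  thus thesis
    using that[of vis' q'] fold_visit[OF trans[OF r[symmetric] v]] succs unfolding c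
    by auto
qed

lemma layer_Suc:
  "succs adj `` layer (succs adj) Q i - (\<Union>j\<le>i. (succs adj ^^ j) `` Q) = layer (succs adj) Q (Suc i)"
    (is "?E `` _ - ?V = _")
proof
  show "?E `` layer ?E Q i - ?V \<subseteq> layer ?E Q (Suc i)"
    by (force simp: layer_def less_Suc_eq_le)
  show "layer ?E Q (Suc i) \<subseteq> ?E `` layer ?E Q i - ?V"
  proof
    fix y assume y: "y \<in> layer ?E Q (Suc i)"
    then obtain x z where xz: "x \<in> Q" "(x, z) \<in> ?E ^^ i" "(z, y) \<in> ?E"
      by (auto simp: layer_def)
    \<comment> \<open>If the predecessor \<open>z\<close> were nearer than \<open>i\<close>, then
      \<open>y\<close> would be nearer than \<open>Suc i\<close>.\<close>
    have "z \<notin> (?E ^^ j) `` Q" if "j < i" for j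
    proof
      assume "z \<in> (?E ^^ j) `` Q"
      hence "y \<in> (?E ^^ Suc j) `` Q" using xz(3) by auto
      thus False using y that by (auto simp: layer_def simp del: relpow.simps)
    qed
    hence "z \<in> layer ?E Q i" using xz by (auto simp: layer_def)
    thus "y \<in> ?E `` layer ?E Q i - ?V"
      using xz(3) y by (auto simp: layer_def less_Suc_eq_le)
  qed
qed

text \<open>The hypotheses are the loop invariant: everything within distance \<open>i\<close> is
  marked, and the queue holds level \<open>i\<close>.\<close>

lemma bfs_layer_aux:
  assumes "vis = (\<Union>j\<le>i. (succs adj ^^ j) `` Q)" "set q = layer (succs adj) Q i"
  shows "set (fst (bfs adj k vis q)) = layer (succs adj) Q (i + k)"
  using assms
proof (induction k arbitrary: i vis q)
  case (Suc k)
  obtain vis' q' where b: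
    "bfs adj (Suc k) vis q = (fst (bfs adj k vis' q'),
        1 + (\<Sum>x\<leftarrow>q. 1 + length (adj x)) + snd (bfs adj k vis' q'))"
    "vis' = vis \<union> succs adj `` set q" "set q' = succs adj `` set q - vis"
    by (rule bfs_Suc)
  have q': "set q' = layer (succs adj) Q (Suc i)"
    using b(3) Suc.prems layer_Suc[of adj Q i] by simp
  have "vis' = vis \<union> set q'" using b(2,3) by auto
  also have "\<dots> = (\<Union>j\<le>Suc i. (succs adj ^^ j) `` Q)"
    unfolding q' Suc.prems(1) layer_def by (auto simp: atMost_Suc less_Suc_eq_le)
  finally show ?case using Suc.IH[OF _ q'] by (simp add: b(1) del: bfs.simps)
qed auto

lemma bfs_layer: "set (fst (bfs adj k (set q) q)) = layer (succs adj) (set q) k"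
  using bfs_layer_aux[where vis = "set q" and i = 0 and Q = "set q" and q = q] by (simp add: layer_def)

text \<open>Every vertex is expanded at most once; those in \<open>vis - set q\<close> have been expanded before.\<close>

lemma bfs_cost:
  assumes "finite V" "succs adj `` V \<subseteq> V" "vis \<subseteq> V" "set q \<subseteq> vis" "distinct q"
  shows "snd (bfs adj k vis q) \<le> k + (\<Sum>x\<in>V - (vis - set q). 1 + length (adj x))"
  using assms(3-)
proof (induction k arbitrary: vis q)
  case (Suc k)
  obtain vis' q' where b:
    "bfs adj (Suc k) vis q = (fst (bfs adj k vis' q'),
        1 + (\<Sum>x\<leftarrow>q. 1 + length (adj x)) + snd (bfs adj k vis' q'))"
    "vis' = vis \<union> succs adj `` set q" "set q' = succs adj `` set q - vis" "distinct q'"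
    by (rule bfs_Suc)
  have "vis' \<subseteq> V" "set q' \<subseteq> vis'" using b(2,3) Suc.prems assms(2) by blast+
  hence "snd (bfs adj k vis' q') \<le> k + (\<Sum>x\<in>V - (vis' - set q'). 1 + length (adj x))"
    using Suc.IH b(4) by simp
  \<comment> \<open>After this level the expanded vertices are those of \<open>vis\<close>, so
    exactly the terms of \<open>set q\<close> have left the sum and can pay for the level.\<close>
  also have "vis' - set q' = vis" using b(2,3) by auto
  finally have "snd (bfs adj (Suc k) vis q) \<le> Suc k +
      ((\<Sum>x\<in>set q. 1 + length (adj x)) + (\<Sum>x\<in>V - vis. 1 + length (adj x)))"
    using Suc.prems(3) by (simp add: b(1) sum_list_distinct_conv_sum_set del: bfs.simps)
  also have "(\<Sum>x\<in>set q. 1 + length (adj x)) + (\<Sum>x\<in>V - vis. 1 + length (adj x)) =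
      (\<Sum>x\<in>set q \<union> (V - vis). 1 + length (adj x))"
    using Suc.prems assms(1) by (intro sum.union_disjoint[symmetric]) auto
  also have "set q \<union> (V - vis) = V - (vis - set q)" using Suc.prems by auto
  finally show ?case by simp
qed auto

subsection \<open>Detection and coalescence\<close>

definition open_graph :: "nat \<Rightarrow> nat set set \<Rightarrow> nat \<Rightarrow> (int \<Rightarrow> bool) \<Rightarrow> (nat set \<times> int) rel" where
  "open_graph n CC T B = {(x, y). x \<in> witness_verts n CC T \<and> y \<in> witness_verts n CC T \<and>
     open_vert n B x \<and> open_vert n B y \<and> witness_edge n x y}"

definition open_roots :: "nat \<Rightarrow> nat set set \<Rightarrow> nat \<Rightarrow> (int \<Rightarrow> bool) \<Rightarrow> (nat set \<times> int) set" where
  "open_roots n CC T B = {x \<in> witness_verts n CC T. open_vert n B x \<and> int T - int n < snd x}"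

text \<open>By \<open>witness_edgeD\<close> the restricted search range loses no edge; conversely
  every tested pair goes back in time, so that intersecting stamps make it an edge.\<close>

lemma succs_edge_table:
  assumes hg: "hypergraph n (set Es)"
  shows "succs (fst (edge_table n Es (fst (neighbours Es (fst (incidence Es)))) T
            (fst (open_table n Es T B)))) = open_graph n (set Es) T B"
proof -
  define nb where "nb = fst (neighbours Es (fst (incidence Es)))"
  have fin: "\<And>C. C \<in> set Es \<Longrightarrow> finite C" using finite_edges[OF hg] by blast
  have nb: "set (nb C) = {C' \<in> set Es. C \<inter> C' \<noteq> {}}" if "C \<in> set Es" for C
    using neighbours_props(1)[OF fin that] by (simp add: nb_def)
  have tests: "(x, y) \<in> set (edge_tests n Es nb T)"
    if "x \<in> witness_verts n (set Es) T" "y \<in> witness_verts n (set Es) T" "witness_edge n x y" for x y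
  proof -
    obtain C t C' t' where xy: "x = (C, t)" "y = (C', t')" by (metis surj_pair)
    have "t' < t" "t - int n < t'" "C \<inter> C' \<noteq> {}"
      using that xy witness_edgeD[OF hg] by (auto simp: witness_verts_def)
    moreover have "C \<in> set Es" "C' \<in> set Es" "t \<in> set (slots n C 1 (int T))" "scan n t' \<in> C'"
      using that xy by (auto simp: witness_verts_def set_slots)
    moreover from calculation have "C' \<in> set (nb C)" "t' \<in> set (slots n C' (t - int n) (t - 1))"
      using nb by (auto simp: set_slots)
    ultimately show ?thesis unfolding edge_tests_def xy by auto
  qed
  have less: "snd y < snd x" if "(x, y) \<in> set (edge_tests n Es nb T)" for x y
    using that by (auto simp: edge_tests_def set_slots)
  have "y \<in> set (fst (edge_table n Es nb T (fst (open_table n Es T B))) x) \<longleftrightarrow>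
      (x, y) \<in> open_graph n (set Es) T B" for x y
  proof -
    have "y \<in> set (fst (edge_table n Es nb T (fst (open_table n Es T B))) x) \<longleftrightarrow>
      (x, y) \<in> set (edge_tests n Es nb T) \<and> stamps n x \<inter> stamps n y \<noteq> {} \<and>
      fst (open_table n Es T B) x \<and> fst (open_table n Es T B) y"
      unfolding edge_table_eq by force
    thus ?thesis using tests[of x y] less[of x y]
      unfolding open_graph_def open_table_eq by (auto simp: witness_edge_def)
  qed
  thus ?thesis unfolding nb_def succs_def by auto
qed

lemma set_roots_eq:
  "set (fst (roots n Es T (fst (open_table n Es T B)))) = open_roots n (set Es) T B"
  unfolding set_roots open_table_eq by (auto simp: open_roots_def witness_verts_def)

lemma detect_answer_iff:
  assumes "hypergraph n (set Es)"
  shows "detect_answer n Es L B \<longleftrightarrow>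
     layer (open_graph n (set Es) (horizon n L) B) (open_roots n (set Es) (horizon n L) B) (L - 1) \<noteq> {}"
proof -
  define T where "T = horizon n L"
  define q where "q = fst (roots n Es T (fst (open_table n Es T B)))"
  define adj where "adj = fst (edge_table n Es (fst (neighbours Es (fst (incidence Es)))) T
            (fst (open_table n Es T B)))"
  have "detect_answer n Es L B \<longleftrightarrow> fst (bfs adj (L - 1) (set q) q) \<noteq> []"
    unfolding detect_answer_def detect_def
    by (simp add: case_prod_beta Let_def adj_def q_def T_def)
  also have "\<dots> \<longleftrightarrow> layer (succs adj) (set q) (L - 1) \<noteq> {}"
    unfolding bfs_layer[symmetric] by simp
  finally show ?thesis
    by (simp only: succs_edge_table[OF assms] adj_def q_def set_roots_eq T_def)
qed

text \<open>A chord that skips ahead would give a shorter walk to \<open>y\<close>. Chords that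
  point backwards are not treated here; in the witness graph the order of time excludes
  them.\<close>

lemma layer_path:
  assumes "y \<in> layer E Q k"
  obtains f where "f 0 \<in> Q" "f k = y" "\<And>i. i < k \<Longrightarrow> (f i, f (Suc i)) \<in> E"
    "\<And>i j. i < j \<Longrightarrow> j \<le> k \<Longrightarrow> (f i, f j) \<in> E \<Longrightarrow> j = Suc i"
proof -
  obtain x where x: "x \<in> Q" "(x, y) \<in> E ^^ k" using assms by (auto simp: layer_def)
  then obtain f where f: "f 0 = x" "f k = y" "\<And>i. i < k \<Longrightarrow> (f i, f (Suc i)) \<in> E"
    by (auto simp: relpow_fun_conv)
  have sub: "(f i, f (i + d)) \<in> E ^^ d" if "i + d \<le> k" for i d
    using that by (induction d) (auto intro!: f(3) relcompI)
  have "j = Suc i" if ij: "i < j" "j \<le> k" "(f i, f j) \<in> E" for i j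
  proof (rule ccontr)
    assume "j \<noteq> Suc i"
    have "(f 0, f i) \<in> E ^^ i" using sub[of 0 i] ij by simp
    hence "(f 0, f j) \<in> E ^^ Suc i" using ij by auto
    moreover have "(f j, f k) \<in> E ^^ (k - j)" using sub[of j "k - j"] ij by simp
    ultimately have "(f 0, f k) \<in> E ^^ (Suc i + (k - j))"
      unfolding relpow_add by blast
    moreover have "Suc i + (k - j) < k" using ij \<open>j \<noteq> Suc i\<close> by simp
    ultimately have "y \<in> (\<Union>i<k. (E ^^ i) `` Q)" using x f by blast
    thus False using assms by (auto simp: layer_def)
  qed
  thus thesis using that f x by blast
qed

text \<open>A shortest path has no chords, hence is induced.\<close>

lemma detect_answer_imp_bad_event:
  assumes hg: "hypergraph n (set Es)" and L: "1 \<le> L" and "detect_answer n Es L B"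
  shows "bad_event n (set Es) L B"
proof -
  define T where "T = horizon n L"
  define E where "E = open_graph n (set Es) T B"
  have n: "0 < n" using hg by (simp add: hypergraph_def)
  obtain y where "y \<in> layer E (open_roots n (set Es) T B) (L - 1)"
    using assms unfolding detect_answer_iff[OF hg] E_def T_def by blast
  then obtain f where f: "f 0 \<in> open_roots n (set Es) T B"
    "\<And>i. i < L - 1 \<Longrightarrow> (f i, f (Suc i)) \<in> E"
    "\<And>i j. i < j \<Longrightarrow> j \<le> L - 1 \<Longrightarrow> (f i, f j) \<in> E \<Longrightarrow> j = Suc i"
    using layer_path by (metis (no_types, lifting))
  have V: "f i \<in> witness_verts n (set Es) T \<and> open_vert n B (f i)" if "i < L" for i
  proof (cases i)
    case 0 thus ?thesis using f(1) by (auto simp: open_roots_def)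
  next
    case (Suc k) thus ?thesis using f(2)[of k] that by (auto simp: E_def open_graph_def)
  qed
  have dec: "snd (f (i + d)) \<le> snd (f i) - int d" if "i + d < L" for i d
    using that
  proof (induction d)
    case (Suc d)
    hence "(f (i + d), f (Suc (i + d))) \<in> E" by (intro f(2)) simp
    thus ?case using Suc by (auto simp: E_def open_graph_def witness_edge_def)
  qed auto
  have lt: "snd (f j) < snd (f i)" if "i < j" "j < L" for i j
    using dec[of i "j - i"] that by simp
  define p where "p = map f [0..<L]"
  have p: "length p = L" "\<And>i. i < L \<Longrightarrow> p ! i = f i" by (auto simp: p_def)
  have edges: "witness_edge n (f i) (f j) \<longleftrightarrow> j = Suc i" if "i < L" "j < L" for i j
  proof
    assume e: "witness_edge n (f i) (f j)"
    hence "snd (f j) < snd (f i)" by (simp add: witness_edge_def)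
    \<comment> \<open>Times decrease strictly along the path and along edges, so no edge leads back
      to an earlier position.\<close>
    hence "i < j" using lt[of j i] that by (metis linorder_neqE_nat order.asym order.irrefl)
    moreover have "(f i, f j) \<in> E" using e V that by (auto simp: E_def open_graph_def)
    ultimately show "j = Suc i" using f(3) that by simp
  next
    assume "j = Suc i"
    thus "witness_edge n (f i) (f j)" using f(2)[of i] that by (auto simp: E_def open_graph_def)
  qed
  have "inj_on f {0..<L}"
    using lt by (intro linorder_inj_onI) (metis atLeastLessThan_iff less_irrefl, auto)
  hence "distinct p" by (simp add: p_def distinct_map)
  moreover have "set p \<subseteq> witness_verts n (set Es) T" using V by (auto simp: p_def)
  ultimately have "induced_path n (set Es) T p"
    using edges p unfolding induced_path_def by simp
  moreover have "\<forall>x\<in>set p. open_vert n B x" using V by (auto simp: p_def)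
  moreover have "stamps n (hd p) \<inter> {int T - int n<..int T} \<noteq> {}"
  proof -
    obtain C t where Ct: "f 0 = (C, t)" by fastforce
    hence "scan n t \<in> C" "t \<le> int T" "int T - int n < t"
      using f(1) by (auto simp: open_roots_def witness_verts_def)
    hence "t \<in> stamps n (f 0) \<inter> {int T - int n<..int T}"
      using self_in_stamps[OF n] Ct by auto
    moreover have "hd p = f 0" using L by (simp add: p_def hd_map upt_conv_Cons)
    ultimately show ?thesis by auto
  qed
  ultimately show ?thesis using p unfolding bad_event_def T_def by blast
qed

section \<open>Updates and runs on independent sets\<close>

lemma finite_indep_sets: "finite (indep_sets n CC)"
  unfolding indep_sets_def by (rule finite_subset[of _ "{1..n} \<rightarrow>\<^sub>E UNIV"]) (auto intro: finite_PiE)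

lemma all_zero_indep: "hypergraph n CC \<Longrightarrow> all_zero n \<in> indep_sets n CC"
  by (fastforce simp: hypergraph_def indep_sets_def all_zero_def)

lemma update_indep: "\<sigma> \<in> indep_sets n CC \<Longrightarrow> update n CC \<sigma> v r \<in> indep_sets n CC"
  by (simp add: update_def)

lemma run_indep: "\<sigma> \<in> indep_sets n CC \<Longrightarrow> run n CC r t \<sigma> \<in> indep_sets n CC"
  by (induction t) (auto intro: update_indep)

lemma upd_False_indep:
  "\<sigma> \<in> indep_sets n CC \<Longrightarrow> v \<in> {1..n} \<Longrightarrow> \<sigma>(v := False) \<in> indep_sets n CC"
  unfolding indep_sets_def by (auto simp: PiE_def extensional_def)

lemma update_False:
  "\<sigma> \<in> indep_sets n CC \<Longrightarrow> v \<in> {1..n} \<Longrightarrow> update n CC \<sigma> v False = \<sigma>(v := False)"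
  by (simp add: update_def upd_False_indep)

lemma update_other: "w \<noteq> v \<Longrightarrow> update n CC \<sigma> v r w = \<sigma> w"
  by (simp add: update_def)

lemma run_const:
  assumes "s \<le> t" "\<And>i. s < i \<Longrightarrow> i \<le> t \<Longrightarrow> scan n (int i) \<noteq> v"
  shows "run n CC r t \<sigma> v = run n CC r s \<sigma> v"
  using assms
proof (induction t rule: dec_induct)
  case (step t)
  have "v \<noteq> scan n (int (Suc t))" using step.prems[of "Suc t"] step.hyps by auto
  thus ?case using step by (simp add: update_other del: of_nat_Suc)
qed auto

lemma run_at_upd_time:
  assumes n: "0 < n" and v: "v \<in> {1..n}" and "1 \<le> upd_time n v (int t)"
  shows "run n CC r t \<sigma> v = run n CC r (nat (upd_time n v (int t))) \<sigma> v"
proof (rule run_const)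
  note p = upd_time_props[OF n v, of "int t"]
  show "nat (upd_time n v (int t)) \<le> t" using p by simp
  fix i assume i: "nat (upd_time n v (int t)) < i" "i \<le> t"
  show "scan n (int i) \<noteq> v"
  proof
    assume "scan n (int i) = v"
    hence "upd_time n v (int t) = int i" using i p by (intro upd_time_unique n) auto
    thus False using i by simp
  qed
qed

text \<open>Setting a vertex to 0 preserves independence, so an update with bit 0 always succeeds
  and leaves the value 0. The lower bound on the update time ensures that it falls within the
  run.\<close>

lemma run_True_bit:
  assumes n: "0 < n" and v: "v \<in> {1..n}" and \<sigma>: "\<sigma> \<in> indep_sets n CC"
    and s: "1 \<le> upd_time n v (int t)" and "run n CC r t \<sigma> v"
  shows "r (nat (upd_time n v (int t)))"
proof -
  define s where "s = nat (upd_time n v (int t))"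
  have "run n CC r s \<sigma> v" using assms run_at_upd_time by (simp add: s_def)
  moreover obtain k where k: "s = Suc k" using s by (metis s_def gr0_conv_Suc zless_nat_eq_int_zless
        int_one_le_iff_zero_less of_nat_0)
  moreover have "scan n (int s) = v" using upd_time_props(3)[OF n v, of "int t"] s by (simp add: s_def)
  ultimately show ?thesis
    using update_False[OF run_indep[OF \<sigma>] v, of r k] unfolding s_def[symmetric]
    by (cases "r s") (auto simp del: of_nat_Suc)
qed

text \<open>A vertex on which the two runs differ was last updated with bit 1, and exactly one of the
  runs rejected this update because of a hyperedge on which it was otherwise constantly 1.\<close>

lemma discrepancy_step:
  assumes hg: "hypergraph n CC" and \<sigma>: "\<sigma> \<in> indep_sets n CC" "\<tau> \<in> indep_sets n CC"
    and v: "v \<in> {1..n}" and diff: "run n CC r (Suc k) \<sigma> v \<noteq> run n CC r (Suc k) \<tau> v"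
    and sc: "scan n (int (Suc k)) = v"
  obtains C u where "C \<in> CC" "v \<in> C" "r (Suc k)" "u \<in> C" "u \<noteq> v"
    "run n CC r k \<sigma> u \<noteq> run n CC r k \<tau> u"
    "(\<forall>w\<in>C - {v}. run n CC r k \<sigma> w) \<or> (\<forall>w\<in>C - {v}. run n CC r k \<tau> w)"
proof -
  \<comment> \<open>The case that the first run is the one left with 0 at \<open>v\<close>. It is
    stated for fresh colourings so that it can be applied with the roles exchanged.\<close>
  have main: "\<exists>C u. C \<in> CC \<and> v \<in> C \<and> r (Suc k) \<and> u \<in> C \<and> u \<noteq> v \<and>
     run n CC r k \<sigma> u \<noteq> run n CC r k \<tau> u \<and> (\<forall>w\<in>C - {v}. run n CC r k \<sigma> w)"
    if \<sigma>: "\<sigma> \<in> indep_sets n CC" "\<tau> \<in> indep_sets n CC"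
      and F: "\<not> run n CC r (Suc k) \<sigma> v" and Tr: "run n CC r (Suc k) \<tau> v" for \<sigma> \<tau>
  proof -
    let ?X = "run n CC r k \<sigma>" and ?Y = "run n CC r k \<tau>"
    have X: "?X \<in> indep_sets n CC" and Y: "?Y \<in> indep_sets n CC" using \<sigma> run_indep by blast+
    have r: "r (Suc k)"
    proof (rule ccontr)
      assume "\<not> r (Suc k)"
      thus False using Tr update_False[OF Y v] sc by (simp del: of_nat_Suc)
    qed
    have "?X(v := True) \<notin> indep_sets n CC" using F r sc by (auto simp: update_def simp del: of_nat_Suc)
    moreover have "?X(v := True) \<in> {1..n} \<rightarrow>\<^sub>E UNIV"
      using X v by (auto simp: indep_sets_def PiE_def extensional_def)
    ultimately obtain C where C: "C \<in> CC" "\<forall>w\<in>C. (?X(v := True)) w"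
      by (auto simp: indep_sets_def)
    hence X1: "\<forall>w\<in>C - {v}. ?X w" by (metis DiffE fun_upd_other singletonI)
    have "v \<in> C" using C X unfolding indep_sets_def by (smt (verit) fun_upd_apply mem_Collect_eq)
    \<comment> \<open>The other run is still independent after the update, so it has a 0 in
      \<open>C\<close>. This 0 is not at \<open>v\<close>, where that run now has 1; hence it was
      there before the update.\<close>
    moreover have "run n CC r (Suc k) \<tau> \<in> indep_sets n CC" using \<sigma> run_indep by blast
    then obtain u where u: "u \<in> C" "\<not> run n CC r (Suc k) \<tau> u" using C unfolding indep_sets_def by blast
    moreover have "u \<noteq> v" using u Tr by metis
    moreover have "\<not> ?Y u" using u sc \<open>u \<noteq> v\<close> by (simp add: update_other del: of_nat_Suc)
    ultimately show ?thesis using C X1 r by blast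
  qed
  show thesis
  proof (cases "run n CC r (Suc k) \<sigma> v")
    case True
    thus thesis using main[OF \<sigma>(2,1)] diff that by metis
  next
    case False
    thus thesis using main[OF \<sigma>] diff that by metis
  qed
qed

text \<open>Strong induction on \<open>t\<close>: the disagreement at \<open>v\<close> arose at its
  update time \<open>s\<close>, and \<open>discrepancy_step\<close> yields a vertex \<open>u\<close>
  of the same hyperedge on which the runs disagree just before \<open>s\<close>. Requiring the
  update time to be at least \<open>n\<close> makes all stamps of the new vertex positive, so each
  of them is a step of the run.\<close>

lemma discrepancy_chain:
  assumes hg: "hypergraph n CC" and \<sigma>: "\<sigma> \<in> indep_sets n CC" "\<tau> \<in> indep_sets n CC"
  shows "t \<le> T \<Longrightarrow> v \<in> {1..n} \<Longrightarrow> int n \<le> upd_time n v (int t) \<Longrightarrow>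
    run n CC (\<lambda>i. B (int i)) t \<sigma> v \<noteq> run n CC (\<lambda>i. B (int i)) t \<tau> v \<Longrightarrow>
    \<exists>C y. v \<in> C \<and> (C, upd_time n v (int t)) \<in> witness_verts n CC T \<and>
      open_vert n B (C, upd_time n v (int t)) \<and>
      ((C, upd_time n v (int t)), y) \<in> (open_graph n CC T B)\<^sup>* \<and> snd y < 2 * int n"
proof (induction t arbitrary: v rule: less_induct)
  case (less t)
  have n: "0 < n" using hg by (simp add: hypergraph_def)
  define s where "s = upd_time n v (int t)"
  let ?r = "\<lambda>i. B (int i)"
  note v = less.prems(2)
  note p = upd_time_props[OF n v, of "int t", folded s_def]
  have s: "int n \<le> s" "s \<le> int t" using less.prems p by (auto simp: s_def)
  then obtain k where k: "s = int (Suc k)" using n by (metis zero_less_imp_eq_int gr0_implies_Suc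
        of_nat_0_less_iff order_less_le_trans)
  have upd: "upd_time n v (int (Suc k)) = s" using p by (intro upd_time_unique n) (auto simp: k)
  have diff: "run n CC ?r (Suc k) \<sigma> v \<noteq> run n CC ?r (Suc k) \<tau> v"
    using less.prems(4) run_at_upd_time[OF n v, of t CC ?r] n s unfolding s_def[symmetric] k
    by (simp del: of_nat_Suc run.simps)
  obtain C u where C: "C \<in> CC" "v \<in> C" "?r (Suc k)" "u \<in> C" "u \<noteq> v"
    "run n CC ?r k \<sigma> u \<noteq> run n CC ?r k \<tau> u"
    "(\<forall>w\<in>C - {v}. run n CC ?r k \<sigma> w) \<or> (\<forall>w\<in>C - {v}. run n CC ?r k \<tau> w)"
    using discrepancy_step[OF hg \<sigma> v diff] p k by metis
  have sub: "C \<subseteq> {1..n}" using hg C by (simp add: hypergraph_def)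
  \<comment> \<open>Time \<open>s\<close> updates \<open>v\<close> only, so the last update of any
    other vertex is the same seen from \<open>k\<close> and from \<open>s\<close>.\<close>
  have other: "upd_time n w (int k) = upd_time n w s" if w: "w \<in> C" "w \<noteq> v" for w
  proof (rule upd_time_eq[OF n])
    show "w \<in> {1..n}" using w sub by blast
    hence q: "upd_time n w s \<le> s" "scan n (upd_time n w s) = w" using upd_time_props n by auto
    hence "upd_time n w s \<noteq> s" using p w by metis
    thus "upd_time n w s \<le> int k" using q k by simp
  qed (simp add: k)
  have pos: "1 \<le> upd_time n w s" if "w \<in> C" for w
    using upd_time_props(1)[OF n, of w s] that sub s by auto
  have opn: "open_vert n B (C, s)"
  proof -
    \<comment> \<open>At \<open>v\<close> the attempted update had bit 1. On the rest of
      \<open>C\<close> one of the runs is constantly 1 at time \<open>k\<close>, and a value 1 stems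
      from a bit 1.\<close>
    have "B (upd_time n w s)" if w: "w \<in> C" for w
    proof (cases "w = v")
      case True thus ?thesis using C(3) upd k by simp
    next
      case False
      have *: "1 \<le> upd_time n w (int k)" using pos[OF w] other[OF w False] by simp
      have "w \<in> {1..n}" using w sub by blast
      hence "?r (nat (upd_time n w (int k)))"
        using C(7) w False run_True_bit[OF n _ \<sigma>(1) *] run_True_bit[OF n _ \<sigma>(2) *] by blast
      thus ?thesis using * other[OF w False] by simp
    qed
    thus ?thesis by (auto simp: open_vert_def stamps_def)
  qed
  have V: "(C, s) \<in> witness_verts n CC T"
    using C p s less.prems(1) n by (auto simp: witness_verts_def)
  define s' where "s' = upd_time n u s"
  have u: "u \<in> {1..n}" using C sub by blast
  have s': "s - int n < s'" "s' \<le> int k"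
    using upd_time_props[OF n u, of s] other[OF C(4,5)] upd_time_props(2)[OF n u, of "int k"]
    by (auto simp: s'_def)
  show ?case
  proof (cases "int n \<le> s'")
    case False
    \<comment> \<open>The chain stops here with \<open>y\<close> being the vertex itself:
      \<open>s - n < s'\<close> and \<open>s' < n\<close>.\<close>
    hence "snd (C, s) < 2 * int n" using s' by simp
    thus ?thesis using C V opn unfolding s_def[symmetric] by blast
  next
    case True
    have "k < t" "k \<le> T" using k s less.prems(1) by auto
    then obtain C' y where C': "u \<in> C'" "(C', s') \<in> witness_verts n CC T" "open_vert n B (C', s')"
       "((C', s'), y) \<in> (open_graph n CC T B)\<^sup>*" "snd y < 2 * int n"
      using less.IH[OF _ _ u _ C(6)] True other[OF C(4,5)] unfolding s'_def by auto
    have "upd_time n u s' = s'" unfolding s'_def using upd_time_props[OF n u, of s]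
      by (intro upd_time_eq n u) auto
    \<comment> \<open>Both hyperedges contain \<open>u\<close>, whose last update is at
      \<open>s'\<close> whether seen from \<open>s\<close> or from \<open>s'\<close> itself.\<close>
    hence "s' \<in> stamps n (C, s) \<inter> stamps n (C', s')"
      using C(4) C'(1) by (auto simp: stamps_def s'_def image_iff) metis
    hence "((C, s), (C', s')) \<in> open_graph n CC T B"
      using V C' opn s' k by (auto simp: open_graph_def witness_edge_def)
    thus ?thesis using C V opn C' unfolding s_def[symmetric]
      by (meson converse_rtrancl_into_rtrancl)
  qed
qed

text \<open>Along an edge the time drops by less than \<open>n\<close>, so that a vertex with time below \<open>2 * n\<close> has
  distance at least \<open>L - 1\<close> from the roots.\<close>

lemma coalescence:
  assumes hg: "hypergraph n (set Es)" and L: "1 \<le> L" and no: "\<not> detect_answer n Es L B"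
    and \<sigma>: "\<sigma> \<in> indep_sets n (set Es)" "\<tau> \<in> indep_sets n (set Es)"
  shows "run n (set Es) (\<lambda>i. B (int i)) (horizon n L) \<sigma> = run n (set Es) (\<lambda>i. B (int i)) (horizon n L) \<tau>"
proof (rule ccontr)
  define T where "T = horizon n L"
  define E where "E = open_graph n (set Es) T B"
  define Q where "Q = open_roots n (set Es) T B"
  have n: "0 < n" using hg by (simp add: hypergraph_def)
  let ?X = "run n (set Es) (\<lambda>i. B (int i)) T \<sigma>" and ?Y = "run n (set Es) (\<lambda>i. B (int i)) T \<tau>"
  assume "run n (set Es) (\<lambda>i. B (int i)) (horizon n L) \<sigma> \<noteq> run n (set Es) (\<lambda>i. B (int i)) (horizon n L) \<tau>"
  then obtain v where diff: "?X v \<noteq> ?Y v" by (auto simp: T_def)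
  moreover have "?X \<in> {1..n} \<rightarrow>\<^sub>E UNIV" "?Y \<in> {1..n} \<rightarrow>\<^sub>E UNIV"
    using run_indep[OF \<sigma>(1)] run_indep[OF \<sigma>(2)] by (auto simp: indep_sets_def)
  ultimately have v: "v \<in> {1..n}" by (metis PiE_arb)
  define s where "s = upd_time n v (int T)"
  have p: "int T - int n < s" "s \<le> int T" using upd_time_props[OF n v, of "int T"] by (auto simp: s_def)
  have TL: "int T = int n * int L + int n" by (simp add: T_def horizon_def algebra_simps)
  have "int n \<le> int n * int L" using L n by simp
  hence "int n \<le> s" using p TL by linarith
  then obtain C y where y: "(C, s) \<in> witness_verts n (set Es) T" "open_vert n B (C, s)"
      "((C, s), y) \<in> E\<^sup>*" "snd y < 2 * int n"
    using discrepancy_chain[OF hg \<sigma> order.refl v _ diff] unfolding s_def E_def by blast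
  hence root: "(C, s) \<in> Q" using p by (auto simp: Q_def open_roots_def)
  define P where "P = (\<lambda>d. y \<in> (E ^^ d) `` Q)"
  have "\<exists>d. P d" using y(3) root by (auto simp: P_def rtrancl_power)
  define d where "d = (LEAST d. P d)"
  have d: "P d" "\<And>i. i < d \<Longrightarrow> \<not> P i"
    using LeastI_ex[OF \<open>\<exists>d. P d\<close>] not_less_Least by (auto simp: d_def)
  obtain x where x: "x \<in> Q" "(x, y) \<in> E ^^ d" using d(1) by (auto simp: P_def)
  have drop: "snd a - int k * int n \<le> snd b" if "(a, b) \<in> E ^^ k" for a b k
    using that
  proof (induction k arbitrary: b)
    case (Suc k)
    then obtain c where c: "(a, c) \<in> E ^^ k" "(c, b) \<in> E" by auto
    have "snd c - int n < snd b"
      using c(2) witness_edgeD(2)[OF hg, of "fst c" "fst b" "snd c" "snd b"]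
      by (auto simp: E_def open_graph_def witness_verts_def)
    thus ?case using Suc.IH[OF c(1)] by (simp add: algebra_simps)
  qed auto
  have "L - 1 \<le> d"
  proof (rule ccontr)
    assume "\<not> L - 1 \<le> d"
    hence "int d + 2 \<le> int L" by linarith
    hence "(int d + 2) * int n \<le> int L * int n" by (intro mult_right_mono) auto
    moreover have "int T - int n < snd x" using x(1) by (auto simp: Q_def open_roots_def)
    ultimately show False using drop[OF x(2)] y(4) TL by (simp add: algebra_simps)
  qed
  \<comment> \<open>Cut the shortest walk to \<open>y\<close> after \<open>L - 1\<close> edges; a
    quicker way to the cut point \<open>z\<close> would also be a quicker way to
    \<open>y\<close>.\<close>
  hence "(x, y) \<in> E ^^ ((L - 1) + (d - (L - 1)))" using x by simp
  then obtain z where z: "(x, z) \<in> E ^^ (L - 1)" "(z, y) \<in> E ^^ (d - (L - 1))"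
    unfolding relpow_add by blast
  have "z \<notin> (E ^^ i) `` Q" if "i < L - 1" for i
  proof
    assume "z \<in> (E ^^ i) `` Q"
    hence "P (i + (d - (L - 1)))" using z(2) unfolding P_def relpow_add by blast
    thus False using d(2)[of "i + (d - (L - 1))"] that \<open>L - 1 \<le> d\<close> by linarith
  qed
  hence "z \<in> layer E Q (L - 1)" using z x by (auto simp: layer_def)
  thus False using no detect_answer_iff[OF hg] by (auto simp: E_def Q_def T_def)
qed

subsection \<open>Running time of a round\<close>

definition meets :: "nat set set \<Rightarrow> nat set \<Rightarrow> nat set set" where
  "meets CC C = {C' \<in> CC. C \<inter> C' \<noteq> {}}"

text \<open>The contribution of \<open>C\<close> to the double sum in the running time.\<close>

definition weight :: "nat set set \<Rightarrow> nat set \<Rightarrow> nat" where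
  "weight CC C = (\<Sum>C'\<in>meets CC C. card C' * card C)"

context
  fixes n :: nat and Es :: "nat set list"
  assumes hg: "hypergraph n (set Es)" and distinct_Es: "distinct Es"
begin

abbreviation "total_weight \<equiv> \<Sum>C\<in>set Es. weight (set Es) C"

lemma n_pos: "0 < n" using hg by (simp add: hypergraph_def)

lemma card_pos: "C \<in> set Es \<Longrightarrow> 1 \<le> card C"
  using hg finite_edges[OF hg] by (simp add: hypergraph_def Suc_le_eq card_gt_0_iff)

lemma finite_meets: "finite (meets (set Es) C)" by (simp add: meets_def)

text \<open>A nonempty hyperedge meets itself, which gives the square term; every neighbour has at
  least one vertex, which gives the bound by the number of neighbours.\<close>

lemma weight_ge:
  assumes "C \<in> set Es"
  shows "card C * card C \<le> weight (set Es) C" "card (meets (set Es) C) * card C \<le> weight (set Es) C"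
    "card C \<le> weight (set Es) C" "1 \<le> weight (set Es) C" "card (meets (set Es) C) \<le> weight (set Es) C"
proof -
  have "C \<in> meets (set Es) C" using assms hg by (auto simp: meets_def hypergraph_def)
  thus 1: "card C * card C \<le> weight (set Es) C"
    unfolding weight_def by (intro member_le_sum[where f = "\<lambda>C'. card C' * card C"] finite_meets) auto
  thus "card C \<le> weight (set Es) C" "1 \<le> weight (set Es) C"
    using card_pos[OF assms] by (auto intro: order_trans[OF _ 1])
  have "card (meets (set Es) C) * card C = (\<Sum>C'\<in>meets (set Es) C. 1 * card C)" by simp
  also have "\<dots> \<le> weight (set Es) C"
    unfolding weight_def by (intro sum_mono mult_right_mono card_pos) (auto simp: meets_def)
  finally show 2: "card (meets (set Es) C) * card C \<le> weight (set Es) C" .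
  thus "card (meets (set Es) C) \<le> weight (set Es) C"
    using card_pos[OF assms] by (intro order_trans[OF _ 2]) auto
qed

lemma sum_list_le_weight:
  assumes "\<And>C. C \<in> set Es \<Longrightarrow> g C \<le> k * weight (set Es) C"
  shows "(\<Sum>C\<leftarrow>Es. g C) \<le> k * total_weight"
proof -
  have "(\<Sum>C\<leftarrow>Es. g C) = (\<Sum>C\<in>set Es. g C)"
    by (rule sum_list_distinct_conv_sum_set[OF distinct_Es])
  also have "\<dots> \<le> (\<Sum>C\<in>set Es. k * weight (set Es) C)" by (intro sum_mono assms)
  finally show ?thesis by (simp add: sum_distrib_left)
qed

section \<open>Bounding each program by the total weight\<close>

lemma incidence_cost_le: "snd (incidence Es) \<le> 2 * total_weight"
  unfolding incidence_cost
  by (rule sum_list_le_weight) (use weight_ge in fastforce)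

lemma length_incidence:
  assumes "C \<in> set Es" "v \<in> C"
  shows "length (fst (incidence Es) v) \<le> card (meets (set Es) C)"
proof -
  have "length (fst (incidence Es) v) = card (set (filter ((\<in>) v) Es))"
    using finite_edges[OF hg] distinct_Es
    by (subst distinct_card) (auto simp: incidence_eq)
  also have "\<dots> \<le> card (meets (set Es) C)"
    using assms by (intro card_mono finite_meets) (auto simp: meets_def)
  finally show ?thesis .
qed

lemma neighbours_cost_le: "snd (neighbours Es (fst (incidence Es))) \<le> 3 * total_weight"
  unfolding neighbours_cost
proof (rule sum_list_le_weight)
  fix C assume C: "C \<in> set Es"
  have "(\<Sum>v\<leftarrow>elems C. 1 + length (fst (incidence Es) v)) \<le> (\<Sum>v\<leftarrow>elems C. 1 + card (meets (set Es) C))"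
    using length_incidence[OF C] finite_edges[OF hg C] by (intro sum_list_mono) (auto simp: elems_def)
  also have "\<dots> = card C + card (meets (set Es) C) * card C"
    by (simp add: sum_list_triv elems_def algebra_simps)
  finally show "1 + (\<Sum>v\<leftarrow>elems C. 1 + length (fst (incidence Es) v)) \<le> 3 * weight (set Es) C"
    using weight_ge[OF C] by linarith
qed

lemma neighbours_list:
  assumes "C \<in> set Es"
  shows "set (fst (neighbours Es (fst (incidence Es))) C) = meets (set Es) C"
    "distinct (fst (neighbours Es (fst (incidence Es))) C)"
  using neighbours_props[OF _ assms] finite_edges[OF hg] by (auto simp: meets_def)

lemma length_slots_le:
  assumes "C \<in> set Es"
  shows "length (slots n C 1 (int (horizon n L))) \<le> (L + 1) * card C"
    "length (slots n C (int (horizon n L) - int n + 1) (int (horizon n L))) \<le> card C"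
    "length (slots n C (t - int n) (t - 1)) \<le> card C"
  using slots_prefix_card[OF n_pos finite_edges[OF hg assms], of "L + 1"]
    slots_window_card[OF n_pos finite_edges[OF hg assms], of "t - 1" "t - int n"]
    slots_window_card[OF n_pos finite_edges[OF hg assms], of "int (horizon n L)"]
  unfolding length_slots horizon_def by simp_all

lemma open_table_cost_le:
  "snd (open_table n Es (horizon n L) B) \<le> 3 * (L + 1) * total_weight"
  unfolding open_table_cost
proof (rule sum_list_le_weight)
  fix C assume C: "C \<in> set Es"
  have "1 + length (slots n C 1 (int (horizon n L))) * (1 + card C) \<le>
      1 + (L + 1) * card C * (1 + card C)"
    by (intro add_left_mono mult_right_mono length_slots_le C) auto
  also have "\<dots> = 1 + (L + 1) * (card C + card C * card C)" by (simp add: algebra_simps)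
  also have "\<dots> \<le> 1 * weight (set Es) C + (L + 1) * (weight (set Es) C + weight (set Es) C)"
    using weight_ge[OF C] by (intro add_mono mult_left_mono) auto
  also have "\<dots> \<le> (L + 1) * weight (set Es) C + (L + 1) * (weight (set Es) C + weight (set Es) C)"
    by (intro add_right_mono mult_right_mono) auto
  finally show "1 + length (slots n C 1 (int (horizon n L))) * (1 + card C) \<le> 3 * (L + 1) * weight (set Es) C"
    by (simp add: algebra_simps)
qed

lemma edge_table_cost_le:
  "snd (edge_table n Es (fst (neighbours Es (fst (incidence Es)))) (horizon n L) opn)
     \<le> 5 * (L + 1) * total_weight"
  unfolding edge_table_cost
proof (rule sum_list_le_weight)
  fix C assume C: "C \<in> set Es"
  define nb where "nb = fst (neighbours Es (fst (incidence Es))) C"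
  define ts where "ts = slots n C 1 (int (horizon n L))"
  have nb: "set nb = meets (set Es) C" "distinct nb" using neighbours_list[OF C] by (auto simp: nb_def)
  \<comment> \<open>There are at most \<open>(L + 1) * card C\<close> times \<open>t\<close>. Each
    costs at most \<open>3 * card C'\<close>: one for the iteration, \<open>card C'\<close> for the
    minimum and at most \<open>card C'\<close> tests.\<close>
  have "(\<Sum>C'\<leftarrow>nb. 1 + (\<Sum>t\<leftarrow>ts. 1 + (card C' + length (slots n C' (t - int n) (t - 1))))) \<le>
    (\<Sum>C'\<leftarrow>nb. 1 + 3 * (L + 1) * (card C' * card C))"
  proof (intro sum_list_mono add_left_mono)
    fix C' assume "C' \<in> set nb"
    hence C': "C' \<in> set Es" using nb by (auto simp: meets_def)
    have "(\<Sum>t\<leftarrow>ts. 1 + (card C' + length (slots n C' (t - int n) (t - 1)))) \<le> (\<Sum>t\<leftarrow>ts. 3 * card C')"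
    proof (rule sum_list_mono)
      fix t
      show "1 + (card C' + length (slots n C' (t - int n) (t - 1))) \<le> 3 * card C'"
        using card_pos[OF C'] length_slots_le(3)[OF C', of t] by linarith
    qed
    also have "\<dots> = length ts * (3 * card C')" by (simp add: sum_list_triv)
    also have "\<dots> \<le> (L + 1) * card C * (3 * card C')"
      unfolding ts_def by (intro mult_right_mono length_slots_le C) auto
    finally show "(\<Sum>t\<leftarrow>ts. 1 + (card C' + length (slots n C' (t - int n) (t - 1)))) \<le>
       3 * (L + 1) * (card C' * card C)" by (simp add: algebra_simps)
  qed
  also have "\<dots> = (\<Sum>C'\<in>meets (set Es) C. 1 + 3 * (L + 1) * (card C' * card C))"
    using nb by (simp add: sum_list_distinct_conv_sum_set)
  also have "\<dots> = card (meets (set Es) C) + 3 * (L + 1) * weight (set Es) C"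
    unfolding weight_def by (simp only: sum.distrib sum_distrib_left card_eq_sum)
  finally have "1 + (\<Sum>C'\<leftarrow>nb. 1 + (\<Sum>t\<leftarrow>ts. 1 + (card C' + length (slots n C' (t - int n) (t - 1)))))
     \<le> 2 * weight (set Es) C + 3 * (L + 1) * weight (set Es) C"
    using weight_ge[OF C] by linarith
  also have "\<dots> \<le> 2 * ((L + 1) * weight (set Es) C) + 3 * (L + 1) * weight (set Es) C"
    by (intro add_right_mono mult_left_mono) auto
  finally show "1 + (\<Sum>C'\<leftarrow>nb. 1 + (\<Sum>t\<leftarrow>ts. 1 + (card C' + length (slots n C' (t - int n) (t - 1)))))
     \<le> 5 * (L + 1) * weight (set Es) C" by (simp add: algebra_simps)
qed

lemma roots_cost_le: "snd (roots n Es (horizon n L) opn) \<le> 2 * total_weight"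
  unfolding roots_cost
proof (rule sum_list_le_weight)
  fix C assume C: "C \<in> set Es"
  show "1 + length (slots n C (int (horizon n L) - int n + 1) (int (horizon n L))) \<le> 2 * weight (set Es) C"
    using length_slots_le(2)[OF C, of L] weight_ge[OF C] by linarith
qed

lemma length_edge_tests:
  "length (edge_tests n Es (fst (neighbours Es (fst (incidence Es)))) (horizon n L))
     \<le> (L + 1) * total_weight"
  unfolding edge_tests_def length_concat_map
proof (rule sum_list_le_weight)
  fix C assume C: "C \<in> set Es"
  define nb where "nb = fst (neighbours Es (fst (incidence Es))) C"
  define ts where "ts = slots n C 1 (int (horizon n L))"
  have nb: "set nb = meets (set Es) C" "distinct nb" using neighbours_list[OF C] by (auto simp: nb_def)
  have "(\<Sum>C'\<leftarrow>nb. \<Sum>t\<leftarrow>ts. length (slots n C' (t - int n) (t - 1))) \<le>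
    (\<Sum>C'\<leftarrow>nb. (L + 1) * (card C' * card C))"
  proof (intro sum_list_mono)
    fix C' assume "C' \<in> set nb"
    hence C': "C' \<in> set Es" using nb by (auto simp: meets_def)
    have "(\<Sum>t\<leftarrow>ts. length (slots n C' (t - int n) (t - 1))) \<le> (\<Sum>t\<leftarrow>ts. card C')"
      by (intro sum_list_mono length_slots_le C')
    also have "\<dots> = length ts * card C'" by (simp add: sum_list_triv)
    also have "\<dots> \<le> (L + 1) * card C * card C'"
      unfolding ts_def by (intro mult_right_mono length_slots_le C) auto
    finally show "(\<Sum>t\<leftarrow>ts. length (slots n C' (t - int n) (t - 1))) \<le> (L + 1) * (card C' * card C)"
      by (simp add: algebra_simps)
  qed
  also have "\<dots> = (L + 1) * weight (set Es) C"
    using nb by (simp add: sum_list_distinct_conv_sum_set weight_def sum_distrib_left)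
  finally show "(\<Sum>C'\<leftarrow>nb. \<Sum>t\<leftarrow>ts. length (map (\<lambda>t'. ((C, t), C', t'))
      (slots n C' (t - int n) (t - 1)))) \<le> (L + 1) * weight (set Es) C"
    by simp
qed

lemma finite_witness_verts: "finite (witness_verts n (set Es) T)"
  by (rule finite_subset[of _ "set Es \<times> {1..int T}"]) (auto simp: witness_verts_def)

lemma card_witness_verts: "card (witness_verts n (set Es) (horizon n L)) \<le> (L + 1) * total_weight"
proof -
  have "witness_verts n (set Es) (horizon n L) =
     (SIGMA C:set Es. {t \<in> {1..int (horizon n L)}. scan n t \<in> C})"
    by (auto simp: witness_verts_def)
  hence "card (witness_verts n (set Es) (horizon n L)) =
     (\<Sum>C\<in>set Es. card {t \<in> {1..int (horizon n L)}. scan n t \<in> C})"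
    by (simp del: atLeastAtMost_iff)
  also have "\<dots> = (\<Sum>C\<leftarrow>Es. length (slots n C 1 (int (horizon n L))))"
    using distinct_Es by (simp add: sum_list_distinct_conv_sum_set length_slots)
  also have "\<dots> \<le> (L + 1) * total_weight"
  proof (rule sum_list_le_weight)
    fix C assume C: "C \<in> set Es"
    have "(L + 1) * card C \<le> (L + 1) * weight (set Es) C"
      by (intro mult_left_mono weight_ge C) auto
    thus "length (slots n C 1 (int (horizon n L))) \<le> (L + 1) * weight (set Es) C"
      using length_slots_le(1)[OF C, of L] by linarith
  qed
  finally show ?thesis .
qed

text \<open>Each entry of \<open>zs\<close> is counted only at \<open>x = f z\<close>, so it
  contributes at most one to the whole sum.\<close>

lemma sum_length_filter_le:
  assumes "finite V"
  shows "(\<Sum>x\<in>V. length (filter (\<lambda>z. f z = x \<and> P z) zs)) \<le> length zs"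
proof (induction zs)
  case (Cons z zs)
  have "(\<Sum>x\<in>V. length (filter (\<lambda>z. f z = x \<and> P z) (z # zs))) =
     (\<Sum>x\<in>V. if f z = x then if P z then 1 else 0 else 0) +
     (\<Sum>x\<in>V. length (filter (\<lambda>z. f z = x \<and> P z) zs))"
    by (subst sum.distrib[symmetric], intro sum.cong) auto
  also have "\<dots> \<le> 1 + length zs"
    using Cons assms by (intro add_mono) (auto simp: sum.delta)
  finally show ?case by simp
qed auto

text \<open>The factor 12 is 3 for the table of open vertices, 5 for the edges, 2 for the roots and
  2 for the search, which pays once per vertex and once per adjacency entry. The separate
  \<open>L\<close> pays for the levels.\<close>

lemma detect_cost_le:
  "snd (detect n Es (fst (neighbours Es (fst (incidence Es)))) L B) \<le> L + 12 * (L + 1) * total_weight"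
proof -
  define T where "T = horizon n L"
  define opn where "opn = fst (open_table n Es T B)"
  define nb where "nb = fst (neighbours Es (fst (incidence Es)))"
  define q where "q = fst (roots n Es T opn)"
  define adj where "adj = fst (edge_table n Es nb T opn)"
  define V where "V = witness_verts n (set Es) T"
  have E: "succs adj = open_graph n (set Es) T B"
    unfolding adj_def nb_def opn_def by (rule succs_edge_table[OF hg])
  have "set q \<subseteq> V" unfolding q_def opn_def set_roots_eq V_def open_roots_def by auto
  moreover have "succs adj `` V \<subseteq> V" unfolding E open_graph_def V_def by auto
  ultimately have "snd (bfs adj (L - 1) (set q) q) \<le> (L - 1) + (\<Sum>x\<in>V - (set q - set q). 1 + length (adj x))"
    using distinct_roots[OF distinct_Es]
    by (intro bfs_cost) (auto simp: V_def finite_witness_verts q_def)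
  also have "\<dots> = (L - 1) + (card V + (\<Sum>x\<in>V. length (adj x)))"
    by (simp only: Diff_cancel Diff_empty sum.distrib card_eq_sum)
  also have "\<dots> \<le> L + ((L + 1) * total_weight + (L + 1) * total_weight)"
  proof (intro add_mono)
    have "(\<Sum>x\<in>V. length (adj x)) \<le> length (edge_tests n Es nb T)"
      unfolding adj_def edge_table_eq length_rev length_map
      by (rule sum_length_filter_le) (simp add: V_def finite_witness_verts)
    thus "(\<Sum>x\<in>V. length (adj x)) \<le> (L + 1) * total_weight"
      using length_edge_tests[of L] by (simp add: nb_def T_def)
  qed (use card_witness_verts in \<open>auto simp: V_def T_def\<close>)
  finally have bfs: "snd (bfs adj (L - 1) (set q) q) \<le> L + 2 * ((L + 1) * total_weight)" by simp
  have "snd (detect n Es nb L B) = snd (open_table n Es T B) + snd (edge_table n Es nb T opn) +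
     snd (roots n Es T opn) + snd (bfs adj (L - 1) (set q) q)"
    unfolding detect_def by (simp add: case_prod_beta Let_def adj_def q_def opn_def T_def)
  moreover have "snd (open_table n Es T B) \<le> 3 * ((L + 1) * total_weight)"
    using open_table_cost_le[of L B] by (simp add: T_def algebra_simps)
  moreover have "snd (edge_table n Es nb T opn) \<le> 5 * ((L + 1) * total_weight)"
    using edge_table_cost_le[of L opn] by (simp add: T_def nb_def algebra_simps)
  moreover have "snd (roots n Es T opn) \<le> 2 * ((L + 1) * total_weight)"
    using roots_cost_le[of L opn] by (simp add: T_def algebra_simps)
  ultimately have "snd (detect n Es nb L B) \<le> L + 12 * ((L + 1) * total_weight)"
    using bfs by linarith
  thus ?thesis by (simp add: nb_def algebra_simps)
qed

lemma run_timed_cost_le: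
  "snd (run_timed n (set Es) (fst (incidence Es)) r (n * k) \<sigma>) \<le> n * k + 2 * (k * total_weight)"
proof -
  define inc where "inc = fst (incidence Es)"
  have "snd (run_timed n (set Es) inc r (n * k) \<sigma>) =
      (\<Sum>i\<leftarrow>[1..<Suc (n * k)]. 1 + (\<Sum>C\<leftarrow>inc (scan n (int i)). 1 + card C))"
    unfolding run_timed_def by (rule snd_for_each) simp
  also have "\<dots> = (\<Sum>i\<in>{1..n * k}. 1 + (\<Sum>C\<leftarrow>inc (scan n (int i)). 1 + card C))"
    by (simp only: sum_list_distinct_conv_sum_set distinct_upt set_upt atLeastLessThanSuc_atLeastAtMost)
  also have "\<dots> = n * k + (\<Sum>i\<in>{1..n * k}. \<Sum>C\<leftarrow>inc (scan n (int i)). 1 + card C)"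
    by (subst sum.distrib) simp
  also have "(\<Sum>i\<in>{1..n * k}. \<Sum>C\<leftarrow>inc (scan n (int i)). 1 + card C) =
     (\<Sum>i\<in>{1..n * k}. \<Sum>C\<in>set Es. if scan n (int i) \<in> C then 1 + card C else 0)"
  proof (rule sum.cong[OF refl])
    fix i
    have "distinct (inc v)" "set (inc v) = {C \<in> set Es. v \<in> C}" for v
      using finite_edges[OF hg] distinct_Es by (simp_all add: inc_def incidence_eq)
    hence "(\<Sum>C\<leftarrow>inc (scan n (int i)). 1 + card C) = (\<Sum>C\<in>{C \<in> set Es. scan n (int i) \<in> C}. 1 + card C)"
      by (simp only: sum_list_distinct_conv_sum_set)
    thus "(\<Sum>C\<leftarrow>inc (scan n (int i)). 1 + card C) = (\<Sum>C\<in>set Es. if scan n (int i) \<in> C then 1 + card C else 0)"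
      by (simp only: sum.inter_filter[OF finite_set])
  qed
  \<comment> \<open>Double counting: instead of the hyperedges inspected at a time, sum over the
    times at which a hyperedge is inspected, of which there are at most
    \<open>k * card C\<close>.\<close>
  also have "\<dots> = (\<Sum>C\<in>set Es. \<Sum>i\<in>{1..n * k}. if scan n (int i) \<in> C then 1 + card C else 0)"
    by (rule sum.swap)
  also have "\<dots> \<le> (\<Sum>C\<in>set Es. 2 * k * weight (set Es) C)"
  proof (rule sum_mono)
    fix C assume C: "C \<in> set Es"
    have "card {i \<in> {1..n * k}. scan n (int i) \<in> C} = card (int ` {i \<in> {1..n * k}. scan n (int i) \<in> C})"
      by (simp add: card_image)
    also have "\<dots> \<le> card {t \<in> {1..int (n * k)}. scan n t \<in> C}"
    proof (rule card_mono)
      show "finite {t \<in> {1..int (n * k)}. scan n t \<in> C}"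
        by (rule finite_subset[of _ "{1..int (n * k)}"]) auto
      have "int i \<le> int (n * k)" if "i \<le> n * k" for i using that by (simp only: of_nat_le_iff)
      thus "int ` {i \<in> {1..n * k}. scan n (int i) \<in> C} \<subseteq> {t \<in> {1..int (n * k)}. scan n t \<in> C}"
        by (auto simp del: of_nat_mult)
    qed
    also have "\<dots> \<le> k * card C"
      by (rule slots_prefix_card[OF n_pos finite_edges[OF hg C]])
    finally have "card {i \<in> {1..n * k}. scan n (int i) \<in> C} * (1 + card C) \<le> k * card C * (1 + card C)"
      by (rule mult_right_mono) simp
    moreover have "(\<Sum>i\<in>{1..n * k}. if scan n (int i) \<in> C then 1 + card C else 0) =
       card {i \<in> {1..n * k}. scan n (int i) \<in> C} * (1 + card C)"
      by (subst sum.inter_filter[symmetric]) auto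
    ultimately have "(\<Sum>i\<in>{1..n * k}. if scan n (int i) \<in> C then 1 + card C else 0) \<le> k * card C * (1 + card C)"
      by simp
    also have "k * card C * (1 + card C) = k * (card C + card C * card C)" by (simp add: algebra_simps)
    also have "\<dots> \<le> k * (weight (set Es) C + weight (set Es) C)"
      by (intro mult_left_mono add_mono weight_ge C) auto
    finally show "(\<Sum>i\<in>{1..n * k}. if scan n (int i) \<in> C then 1 + card C else 0) \<le> 2 * k * weight (set Es) C"
      by (simp add: algebra_simps)
  qed
  finally show ?thesis by (simp add: inc_def sum_distrib_left algebra_simps)
qed

text \<open>Vertices outside all hyperedges do not show in the total weight, yet the sampler draws
  and processes bits for them. The second term accounts for these.\<close>

lemma n_le_size: "n \<le> total_weight + card ({1..n} - \<Union>(set Es))"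
proof -
  have "{1..n} = \<Union>(set Es) \<union> ({1..n} - \<Union>(set Es))" using hg by (auto simp: hypergraph_def)
  hence "n \<le> card (\<Union>(set Es)) + card ({1..n} - \<Union>(set Es))"
    by (metis card_Un_le card_atLeastAtMost diff_Suc_1)
  moreover have "card (\<Union>(set Es)) \<le> (\<Sum>C\<in>set Es. card C)"
    by (rule card_Union_le_sum_card)
  moreover have "\<dots> \<le> total_weight" by (intro sum_mono weight_ge)
  ultimately show ?thesis by linarith
qed

text \<open>With \<open>A\<close> as common unit, 22 is 2 + 3 for the tables, 14 per round (1 for
  the bits and 13 for \<open>detect\<close>) and 3 for the final evaluation. The tables are built
  once, which is absorbed because at least one round takes place.\<close>

lemma cftp_time_le:
  assumes "cftp_halts n L occ R"
  shows "cftp_time n Es L occ R \<le> of_nat (22 * (L + 1) *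
     (total_weight + card ({1..n} - \<Union>(set Es))) * cftp_rounds n L occ R)"
proof -
  define W where "W = total_weight"
  define S where "S = W + card ({1..n} - \<Union>(set Es))"
  define T where "T = horizon n L"
  define J where "J = cftp_rounds n L occ R"
  define nb where "nb = fst (neighbours Es (fst (incidence Es)))"
  have "stops_at n L occ R J"
    using assms unfolding cftp_halts_def J_def cftp_rounds_def by (metis LeastI_ex)
  hence J: "1 \<le> J" by (simp add: stops_at_def)
  have WS: "W \<le> S" "n \<le> S" using n_le_size by (auto simp: S_def W_def)
  have T: "T = n * (L + 1)" by (simp add: T_def horizon_def)
  define A where "A = (L + 1) * S"
  have A: "W \<le> A" "(L + 1) * W \<le> A" "T \<le> A" "L \<le> A"
  proof -
    show "(L + 1) * W \<le> A" unfolding A_def using WS by (intro mult_left_mono) auto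
    show "T \<le> A" unfolding A_def T mult.commute[of n] using WS by (intro mult_left_mono) auto
    show "W \<le> A" using WS by (simp add: A_def trans_le_add1)
    have "(L + 1) * 1 \<le> A" unfolding A_def using WS n_pos by (intro mult_left_mono) auto
    thus "L \<le> A" by simp
  qed
  have AJ: "A \<le> J * A" using J by simp
  have c3: "(\<Sum>j=1..J. T + snd (detect n Es nb L (block T j R))) \<le> J * (14 * A)"
  proof -
    have "(\<Sum>j=1..J. T + snd (detect n Es nb L (block T j R))) \<le> (\<Sum>j=1..J. 14 * A)"
    proof (rule sum_mono)
      fix j
      show "T + snd (detect n Es nb L (block T j R)) \<le> 14 * A"
        using detect_cost_le[of L "block T j R"] A unfolding nb_def W_def[symmetric] mult.assoc
        by linarith
    qed
    thus ?thesis by simp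
  qed
  have "snd (run_timed n (set Es) (fst (incidence Es)) (\<lambda>i. R (int i - int (J * T))) (J * T) (all_zero n))
      \<le> J * T + 2 * (J * ((L + 1) * W))"
    using run_timed_cost_le[of "\<lambda>i. R (int i - int (J * T))" "J * (L + 1)" "all_zero n"]
    unfolding T W_def by (simp only: mult.assoc mult.left_commute[of n] mult.commute)
  also have "\<dots> \<le> J * A + 2 * (J * A)"
    using A by (intro add_mono mult_left_mono) auto
  finally have c4: "snd (run_timed n (set Es) (fst (incidence Es)) (\<lambda>i. R (int i - int (J * T))) (J * T) (all_zero n))
      \<le> 3 * (J * A)" by (simp add: mult.commute)
  have "cftp_time n Es L occ R = of_nat (snd (incidence Es) + snd (neighbours Es (fst (incidence Es))) +
     (\<Sum>j=1..J. T + snd (detect n Es nb L (block T j R))) +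
     snd (run_timed n (set Es) (fst (incidence Es)) (\<lambda>i. R (int i - int (J * T))) (J * T) (all_zero n)))"
    unfolding cftp_time_def using assms
    by (simp add: case_prod_beta Let_def J_def T_def nb_def)
  also have "\<dots> \<le> of_nat (22 * (J * A))"
    using incidence_cost_le neighbours_cost_le c3 c4 A AJ unfolding W_def[symmetric]
    by (intro of_nat_mono) linarith
  also have "22 * (J * A) = 22 * (L + 1) * S * J" by (simp add: A_def algebra_simps)
  finally show ?thesis by (simp only: S_def J_def W_def)
qed

end

subsection \<open>Stationarity of the uniform distribution\<close>

lemma run_cong:
  assumes "\<And>i. 1 \<le> i \<Longrightarrow> i \<le> t \<Longrightarrow> r i = r' i"
  shows "run n CC r t \<sigma> = run n CC r' t \<sigma>"
  using assms by (induction t) auto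

text \<open>A shift by a multiple of \<open>n\<close> leaves the scan in phase.\<close>

lemma run_add:
  assumes "n dvd a"
  shows "run n CC r (a + b) \<sigma> = run n CC (\<lambda>i. r (a + i)) b (run n CC r a \<sigma>)"
proof (induction b)
  case (Suc b)
  have "scan n (int (Suc (a + b))) = scan n (int (Suc b))"
    using assms by (auto simp: scan_def elim!: dvdE simp flip: of_nat_mod of_nat_Suc)
  thus ?case using Suc by (simp del: of_nat_Suc)
qed auto

text \<open>Exchanging the bit \<open>r\<close> with the old value at \<open>v\<close> is an involution.\<close>

lemma update_balanced:
  assumes v: "v \<in> {1..n}"
  shows "card {\<sigma> \<in> indep_sets n CC. update n CC \<sigma> v False \<in> A} +
     card {\<sigma> \<in> indep_sets n CC. update n CC \<sigma> v True \<in> A} = 2 * card (A \<inter> indep_sets n CC)"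
proof -
  let ?O = "indep_sets n CC"
  \<comment> \<open>The exchange takes place only where \<open>v\<close> may be 1. Elsewhere an
    independent set has 0 at \<open>v\<close> and neither bit changes it. In both cases the first
    component is the updated colouring, so \<open>\<phi>\<close> maps the pairs updated into
    \<open>A\<close> bijectively onto the independent sets in \<open>A\<close> paired with a
    bit.\<close>
  define \<phi> where "\<phi> = (\<lambda>(\<sigma>, r). if \<sigma>(v := True) \<in> ?O then (\<sigma>(v := r), \<sigma> v) else (\<sigma>, r))"
  define X where "X = {(\<sigma>, r). \<sigma> \<in> ?O \<and> update n CC \<sigma> v r \<in> A}"
  have fst: "fst (\<phi> (\<sigma>, r)) = update n CC \<sigma> v r" if s: "\<sigma> \<in> ?O" for \<sigma> r
  proof (cases "\<sigma>(v := True) \<in> ?O")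
    case True
    hence "\<sigma>(v := r) \<in> ?O" using upd_False_indep[OF s v] by (cases r) auto
    thus ?thesis using True by (simp only: \<phi>_def update_def prod.case if_True fst_conv)
  next
    case False
    have "\<not> \<sigma> v"
    proof
      assume "\<sigma> v"
      hence "\<sigma>(v := True) = \<sigma>" by (auto simp: fun_eq_iff)
      thus False using False s by simp
    qed
    hence "\<sigma>(v := False) = \<sigma>" by (auto simp: fun_eq_iff)
    thus ?thesis using False by (cases r) (simp_all only: \<phi>_def update_def prod.case if_False fst_conv if_cancel)
  qed
  have inv: "\<phi> (\<phi> z) = z" if "fst z \<in> ?O" for z
    using that by (cases z) (auto simp: \<phi>_def)
  have in_O: "fst (\<phi> z) \<in> ?O" if "fst z \<in> ?O" for z
    using fst[of "fst z" "snd z"] that update_indep by (metis prod.collapse)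
  have "bij_betw \<phi> X ((A \<inter> ?O) \<times> UNIV)"
  proof (rule bij_betw_byWitness[where f' = \<phi>])
    show "\<forall>a\<in>X. \<phi> (\<phi> a) = a" using inv by (auto simp: X_def)
    show "\<forall>a\<in>(A \<inter> ?O) \<times> UNIV. \<phi> (\<phi> a) = a" using inv by auto
    show "\<phi> ` X \<subseteq> (A \<inter> ?O) \<times> UNIV"
    proof
      fix w assume "w \<in> \<phi> ` X"
      then obtain \<sigma> r where z: "w = \<phi> (\<sigma>, r)" "\<sigma> \<in> ?O" "update n CC \<sigma> v r \<in> A" by (auto simp: X_def)
      hence "fst w \<in> A \<inter> ?O" using fst[of \<sigma> r] update_indep[of \<sigma> n CC v r] by simp
      thus "w \<in> (A \<inter> ?O) \<times> UNIV" by (simp add: mem_Times_iff)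
    qed
    show "\<phi> ` ((A \<inter> ?O) \<times> UNIV) \<subseteq> X"
    proof
      fix w assume "w \<in> \<phi> ` ((A \<inter> ?O) \<times> UNIV)"
      then obtain z where z: "w = \<phi> z" "fst z \<in> A" "fst z \<in> ?O" by auto
      have w: "fst w \<in> ?O" using z in_O by simp
      have "fst (\<phi> w) \<in> A" using z inv by simp
      thus "w \<in> X" using w fst[of "fst w" "snd w"] by (simp add: X_def case_prod_beta)
    qed
  qed
  hence "card X = card ((A \<inter> ?O) \<times> (UNIV :: bool set))" by (rule bij_betw_same_card)
  hence "card X = card (A \<inter> ?O) * 2" by (simp add: card_cartesian_product)
  moreover have "X = {\<sigma> \<in> ?O. update n CC \<sigma> v False \<in> A} \<times> {False} \<union>
      {\<sigma> \<in> ?O. update n CC \<sigma> v True \<in> A} \<times> {True}"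
  proof (rule set_eqI)
    fix z :: "(nat \<Rightarrow> bool) \<times> bool"
    show "z \<in> X \<longleftrightarrow> z \<in> {\<sigma> \<in> ?O. update n CC \<sigma> v False \<in> A} \<times> {False} \<union>
      {\<sigma> \<in> ?O. update n CC \<sigma> v True \<in> A} \<times> {True}"
      by (cases z; cases "snd z") (simp_all add: X_def)
  qed
  hence "card X = card {\<sigma> \<in> ?O. update n CC \<sigma> v False \<in> A} + card {\<sigma> \<in> ?O. update n CC \<sigma> v True \<in> A}"
    by (simp add: card_Un_disjoint finite_indep_sets card_cartesian_product disjoint_iff)
  ultimately show ?thesis by simp
qed

lemma finite_bool_lists: "finite {l :: bool list. length l = m \<and> P l}"
  by (rule finite_subset[OF _ finite_lists_length_eq[of UNIV m]]) auto

lemma card_bool_lists_Suc: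
  "card {l :: bool list. length l = Suc m \<and> P l} =
     card {l. length l = m \<and> P (l @ [False])} + card {l. length l = m \<and> P (l @ [True])}"
proof -
  have "{l. length l = Suc m \<and> P l} = (\<lambda>l. l @ [False]) ` {l. length l = m \<and> P (l @ [False])} \<union>
      (\<lambda>l. l @ [True]) ` {l. length l = m \<and> P (l @ [True])}" (is "?L = ?R")
  proof
    show "?L \<subseteq> ?R"
    proof
      fix l assume l: "l \<in> ?L"
      then obtain k b where "l = k @ [b]" by (cases l rule: rev_cases) auto
      thus "l \<in> ?R" using l by (cases b) auto
    qed
  qed auto
  hence "card {l. length l = Suc m \<and> P l} = card ((\<lambda>l. l @ [False]) ` {l. length l = m \<and> P (l @ [False])}) +
      card ((\<lambda>l. l @ [True]) ` {l. length l = m \<and> P (l @ [True])})"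
    by (simp only:, intro card_Un_disjoint) (auto simp: finite_bool_lists)
  moreover have "card ((\<lambda>l. l @ [b]) ` X) = card X" for b :: bool and X
    by (rule card_image) (simp add: inj_on_def)
  ultimately show ?thesis by (simp only:)
qed

text \<open>Stationarity with the denominators cleared: it counts pairs of a start and a bit list.
  The induction splits off the last bit and uses the hypothesis for the two preimages of
  \<open>A\<close> under the last update, whence the general \<open>A\<close>.\<close>

lemma run_stationary:
  assumes n: "0 < n"
  shows "(\<Sum>\<sigma>\<in>indep_sets n CC. card {l. length l = t \<and> run n CC (\<lambda>i. l ! (i - 1)) t \<sigma> \<in> A}) =
     2 ^ t * card (A \<inter> indep_sets n CC)"
proof (induction t arbitrary: A)
  case 0
  have "(\<Sum>\<sigma>\<in>indep_sets n CC. card {l::bool list. length l = 0 \<and> run n CC (\<lambda>i. l ! (i - 1)) 0 \<sigma> \<in> A}) =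
    (\<Sum>\<sigma>\<in>indep_sets n CC. if \<sigma> \<in> A then 1 else 0)"
    by (intro sum.cong) auto
  also have "\<dots> = card (A \<inter> indep_sets n CC)"
    by (simp add: sum.If_cases finite_indep_sets Int_commute)
  finally show ?case by simp
next
  case (Suc t)
  let ?O = "indep_sets n CC" and ?v = "scan n (int (Suc t))"
  have *: "run n CC (\<lambda>i. (l @ [b]) ! (i - 1)) (Suc t) \<sigma> =
       update n CC (run n CC (\<lambda>i. l ! (i - 1)) t \<sigma>) ?v b" if "length l = t" for l b \<sigma>
  proof -
    have "run n CC (\<lambda>i. (l @ [b]) ! (i - 1)) t \<sigma> = run n CC (\<lambda>i. l ! (i - 1)) t \<sigma>"
      using that by (intro run_cong) (auto simp: nth_append)
    thus ?thesis using that by (simp add: nth_append)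
  qed
  have "(\<Sum>\<sigma>\<in>?O. card {l. length l = Suc t \<and> run n CC (\<lambda>i. l ! (i - 1)) (Suc t) \<sigma> \<in> A}) =
    (\<Sum>\<sigma>\<in>?O. card {l. length l = t \<and> run n CC (\<lambda>i. l ! (i - 1)) t \<sigma> \<in> {s. update n CC s ?v False \<in> A}}) +
    (\<Sum>\<sigma>\<in>?O. card {l. length l = t \<and> run n CC (\<lambda>i. l ! (i - 1)) t \<sigma> \<in> {s. update n CC s ?v True \<in> A}})"
    unfolding card_bool_lists_Suc sum.distrib using * by (simp cong: conj_cong del: run.simps of_nat_Suc)
  also have "\<dots> = 2 ^ t * (card ({s. update n CC s ?v False \<in> A} \<inter> ?O) + card ({s. update n CC s ?v True \<in> A} \<inter> ?O))"
    unfolding Suc.IH by (simp add: algebra_simps)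
  also have "{s. update n CC s ?v False \<in> A} \<inter> ?O = {s \<in> ?O. update n CC s ?v False \<in> A}" by auto
  also have "{s. update n CC s ?v True \<in> A} \<inter> ?O = {s \<in> ?O. update n CC s ?v True \<in> A}" by auto
  finally show ?case using update_balanced[OF scan_in[OF n]] by simp
qed

subsection \<open>Finitely many fair bits\<close>

text \<open>The last \<open>m\<close> bits, oldest first, so that entry \<open>i - 1\<close> is the
  bit of step \<open>i\<close> in a run of \<open>m\<close> steps ending at time 0.\<close>

definition bits :: "nat \<Rightarrow> (int \<Rightarrow> bool) \<Rightarrow> bool list" where
  "bits m R = map (\<lambda>i. R (int i - int m)) [1..<Suc m]"

lemma length_bits [simp]: "length (bits m R) = m" by (simp add: bits_def)

lemma nth_bits: "k < m \<Longrightarrow> bits m R ! k = R (int k + 1 - int m)"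
  by (simp add: bits_def add.commute del: upt_Suc)

lemma prob_space_fair_bits: "prob_space fair_bits"
  unfolding fair_bits_def by (intro prob_space_PiM measure_pmf.prob_space_axioms)

lemma measurable_bit:
  assumes "t \<le> 0"
  shows "(\<lambda>R. R t) \<in> measurable fair_bits (count_space UNIV)"
proof -
  have "(\<lambda>R. R t) \<in> measurable fair_bits (measure_pmf (bernoulli_pmf (1/2)))"
    unfolding fair_bits_def using assms by (intro measurable_component_singleton) auto
  thus ?thesis by (simp add: measurable_pmf_measure2)
qed

lemma measurable_bits: "bits m \<in> measurable fair_bits (count_space UNIV)"
proof -
  have "(\<lambda>R. map R xs) \<in> measurable fair_bits (count_space UNIV)" if "set xs \<subseteq> {..0}" for xs
    using that
  proof (induction xs)
    case (Cons t xs)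
    have "(\<lambda>R. b # map R xs) \<in> measurable fair_bits (count_space UNIV)" for b
      using Cons by (intro measurable_compose[where g = "Cons b", OF Cons.IH]) auto
    moreover have "(\<lambda>R. R t) \<in> measurable fair_bits (count_space UNIV)"
      using Cons.prems by (intro measurable_bit) simp
    ultimately have "(\<lambda>R. R t # map R xs) \<in> measurable fair_bits (count_space UNIV)"
      by (rule measurable_compose_countable)
    thus ?case by simp
  qed auto
  moreover have "set (map (\<lambda>i. int i - int m) [1..<Suc m]) \<subseteq> {..0}" by (auto simp del: upt_Suc)
  ultimately have "(\<lambda>R. map R (map (\<lambda>i. int i - int m) [1..<Suc m])) \<in> measurable fair_bits (count_space UNIV)"
    by blast
  thus ?thesis by (simp add: bits_def[abs_def] comp_def del: upt_Suc)
qed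

lemma measurable_bits_event [measurable]: "{R \<in> space fair_bits. P (bits m R)} \<in> sets fair_bits"
proof -
  have "bits m -` {l. P l} \<inter> space fair_bits \<in> sets fair_bits"
    by (rule measurable_sets[OF measurable_bits]) simp
  thus ?thesis by (simp add: vimage_def Collect_conj_eq Int_commute)
qed

lemma prob_bits_eq:
  assumes "length l = m"
  shows "measure fair_bits {R \<in> space fair_bits. bits m R = l} = 1 / 2 ^ m"
proof -
  interpret product_prob_space "\<lambda>_. measure_pmf (bernoulli_pmf (1/2))" "{..0::int}" by unfold_locales
  define J where "J = {1 - int m..0}"
  define X where "X = (\<lambda>i. {l ! nat (i + int m - 1)})"
  \<comment> \<open>Fixing the last \<open>m\<close> bits is a cylinder event over the coordinates
    in \<open>J\<close>, to which the product formula applies.\<close>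
  have "{R \<in> space fair_bits. bits m R = l} =
     prod_emb {..0} (\<lambda>_. measure_pmf (bernoulli_pmf (1/2))) J (Pi\<^sub>E J X)"
  proof -
    have "bits m R = l \<longleftrightarrow> (\<forall>i\<in>J. R i = l ! nat (i + int m - 1))" for R
    proof
      assume b: "bits m R = l"
      show "\<forall>i\<in>J. R i = l ! nat (i + int m - 1)"
      proof
        fix i assume "i \<in> J"
        hence "nat (i + int m - 1) < m" "i = int (nat (i + int m - 1)) + 1 - int m" by (auto simp: J_def)
        thus "R i = l ! nat (i + int m - 1)" using nth_bits[of "nat (i + int m - 1)" m R] b by simp
      qed
    next
      assume "\<forall>i\<in>J. R i = l ! nat (i + int m - 1)"
      thus "bits m R = l" using assms
        by (intro nth_equalityI) (auto simp: nth_bits J_def)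
    qed
    hence "{R \<in> space fair_bits. bits m R = l} = {R \<in> space fair_bits. \<forall>i\<in>J. R i \<in> X i}"
      by (simp add: X_def)
    also have "\<dots> = prod_emb {..0} (\<lambda>_. measure_pmf (bernoulli_pmf (1/2))) J (Pi\<^sub>E J X)"
      unfolding prod_emb_def fair_bits_def vimage_def restrict_PiE_iff by (auto simp: space_PiM)
    finally show ?thesis .
  qed
  moreover have "emeasure fair_bits (prod_emb {..0} (\<lambda>_. measure_pmf (bernoulli_pmf (1/2))) J (Pi\<^sub>E J X))
     = (\<Prod>i\<in>J. emeasure (measure_pmf (bernoulli_pmf (1/2))) (X i))"
    unfolding fair_bits_def by (intro emeasure_PiM_emb) (auto simp: J_def)
  moreover have "\<dots> = (\<Prod>i\<in>J. ennreal (1/2))"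
  proof (intro prod.cong refl)
    fix i
    show "emeasure (measure_pmf (bernoulli_pmf (1/2))) (X i) = ennreal (1/2)"
      unfolding X_def emeasure_pmf_single by (cases "l ! nat (i + int m - 1)") simp_all
  qed
  moreover have "\<dots> = ennreal (1/2) ^ m" by (simp only: prod_constant) (simp add: J_def)
  moreover have "\<dots> = ennreal (1 / 2 ^ m)" by (subst ennreal_power) (auto simp: power_one_over)
  ultimately show ?thesis by (simp add: measure_def)
qed

text \<open>Turns probabilities of events that depend on finitely many bits into counts of
  lists.\<close>

lemma prob_bits:
  "measure fair_bits {R \<in> space fair_bits. P (bits m R)} = card {l. length l = m \<and> P l} / 2 ^ m"
proof -
  interpret prob_space fair_bits by (rule prob_space_fair_bits)
  have "{R \<in> space fair_bits. P (bits m R)} =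
     (\<Union>l\<in>{l. length l = m \<and> P l}. {R \<in> space fair_bits. bits m R = l})" by auto
  hence "prob {R \<in> space fair_bits. P (bits m R)} =
     (\<Sum>l\<in>{l. length l = m \<and> P l}. prob {R \<in> space fair_bits. bits m R = l})"
    by (simp only:, intro finite_measure_finite_Union)
       (auto simp: finite_bool_lists disjoint_family_on_def)
  also have "\<dots> = (\<Sum>l\<in>{l. length l = m \<and> P l}. 1 / 2 ^ m)"
    by (intro sum.cong) (auto simp: prob_bits_eq)
  finally show ?thesis by simp
qed

section \<open>Splitting the bits into rounds\<close>

definition list_block :: "nat \<Rightarrow> bool list \<Rightarrow> int \<Rightarrow> bool" where
  "list_block T l t \<longleftrightarrow> t \<in> {1..int T} \<and> l ! (nat t - 1)"

text \<open>Later rounds reach further into the past, so round \<open>Suc m\<close> uses the oldest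
  \<open>T\<close> bits, at the front of the list.\<close>

lemma block_eq_list_block: "block T (Suc m) R = list_block T (take T (bits (Suc m * T) R))"
proof
  fix t
  show "block T (Suc m) R t = list_block T (take T (bits (Suc m * T) R)) t"
  proof (cases "t \<in> {1..int T}")
    case True
    hence "nat t - 1 < T" by auto
    moreover from this have "nat t - 1 < Suc m * T" by simp
    moreover have "int (nat t - 1) + 1 = t" using True by auto
    ultimately show ?thesis using True nth_bits[of "nat t - 1" "Suc m * T" R]
      unfolding block_def list_block_def by (simp only: nth_take simp_thms)
  qed (auto simp: block_def list_block_def)
qed

lemma drop_bits: "drop T (bits (Suc m * T) R) = bits (m * T) R"
  by (rule nth_equalityI) (simp_all add: nth_bits algebra_simps)

primrec all_blocks :: "(bool list \<Rightarrow> bool) \<Rightarrow> nat \<Rightarrow> nat \<Rightarrow> bool list \<Rightarrow> bool" where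
  "all_blocks P T 0 l \<longleftrightarrow> True"
| "all_blocks P T (Suc m) l \<longleftrightarrow> P (take T l) \<and> all_blocks P T m (drop T l)"

lemma all_blocks_bits:
  "(\<forall>j\<in>{1..m}. occ (block T j R)) \<longleftrightarrow> all_blocks (\<lambda>l. occ (list_block T l)) T m (bits (m * T) R)"
proof (induction m)
  case (Suc m)
  have "(\<forall>j\<in>{1..Suc m}. occ (block T j R)) \<longleftrightarrow> occ (block T (Suc m) R) \<and> (\<forall>j\<in>{1..m}. occ (block T j R))"
    by (auto simp: atLeastAtMostSuc_conv)
  thus ?case unfolding Suc.IH all_blocks.simps drop_bits block_eq_list_block by simp
qed auto

text \<open>The independence of the rounds, in counting form.\<close>

lemma card_all_blocks:
  "card {l. length l = m * T \<and> all_blocks P T m l} = card {l. length l = T \<and> P l} ^ m"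
proof (induction m)
  case 0
  have "{l :: bool list. length l = 0 * T \<and> all_blocks P T 0 l} = {[]}" by auto
  thus ?case by simp
next
  case (Suc m)
  let ?A = "{l. length l = T \<and> P l}" and ?B = "{l. length l = m * T \<and> all_blocks P T m l}"
  have "bij_betw (\<lambda>(a, b). a @ b) (?A \<times> ?B) {l. length l = Suc m * T \<and> all_blocks P T (Suc m) l}"
    by (rule bij_betw_byWitness[where f' = "\<lambda>l. (take T l, drop T l)"]) auto
  hence "card {l. length l = Suc m * T \<and> all_blocks P T (Suc m) l} = card (?A \<times> ?B)"
    by (simp add: bij_betw_same_card)
  thus ?case using Suc by (simp add: card_cartesian_product)
qed

lemma prob_Pi_pmf_bits:
  "measure_pmf.prob (Pi_pmf {1..int T} False (\<lambda>_. bernoulli_pmf (1/2))) {B. occ B} =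
     card {l. length l = T \<and> occ (list_block T l)} / 2 ^ T"
proof -
  define S where "S = PiE_dflt {1..int T} False (\<lambda>_. UNIV :: bool set)"
  have S: "finite S" "card S = 2 ^ T"
    by (auto simp: S_def card_PiE_dflt intro!: finite_PiE_dflt)
  hence "S \<noteq> {}" by auto
  have "bij_betw (list_block T) {l. length l = T \<and> occ (list_block T l)} (S \<inter> {B. occ B})"
  proof (rule bij_betw_byWitness[where f' = "\<lambda>B. map (\<lambda>i. B (int i)) [1..<Suc T]"])
    show "\<forall>l\<in>{l. length l = T \<and> occ (list_block T l)}. map (\<lambda>i. list_block T l (int i)) [1..<Suc T] = l"
      by (auto intro!: nth_equalityI simp: list_block_def simp del: upt_Suc)
    have inv: "list_block T (map (\<lambda>i. B (int i)) [1..<Suc T]) = B" if B: "B \<in> S" for B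
    proof
      fix t
      show "list_block T (map (\<lambda>i. B (int i)) [1..<Suc T]) t = B t"
      proof (cases "t \<in> {1..int T}")
        case True
        hence "nat t - 1 < T" "1 + (nat t - 1) = nat t" "int (nat t) = t" by auto
        thus ?thesis using True by (simp add: list_block_def del: upt_Suc)
      qed (use B in \<open>auto simp: list_block_def S_def PiE_dflt_def\<close>)
    qed
    thus "\<forall>B\<in>S \<inter> {B. occ B}. list_block T (map (\<lambda>i. B (int i)) [1..<Suc T]) = B" by blast
    show "list_block T ` {l. length l = T \<and> occ (list_block T l)} \<subseteq> S \<inter> {B. occ B}"
      by (auto simp: S_def PiE_dflt_def list_block_def)
    show "(\<lambda>B. map (\<lambda>i. B (int i)) [1..<Suc T]) ` (S \<inter> {B. occ B}) \<subseteq> {l. length l = T \<and> occ (list_block T l)}"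
      using inv by (auto simp del: upt_Suc)
  qed
  hence "card {l. length l = T \<and> occ (list_block T l)} = card (S \<inter> {B. occ B})"
    by (rule bij_betw_same_card)
  moreover have "Pi_pmf {1..int T} False (\<lambda>_. bernoulli_pmf (1/2)) = pmf_of_set S"
    unfolding S_def bernoulli_pmf_half_conv_pmf_of_set by (rule Pi_pmf_of_set) auto
  ultimately show ?thesis using S \<open>S \<noteq> {}\<close> by (simp add: measure_pmf_of_set)
qed

lemma le_half_powers_imp_nonpos:
  fixes x :: real
  assumes "\<And>m::nat. x \<le> (1/2) ^ m"
  shows "x \<le> 0"
proof (rule LIMSEQ_le_const)
  show "(\<lambda>m. (1/2::real) ^ m) \<longlonglongrightarrow> 0" by (intro LIMSEQ_power_zero) auto
qed (use assms in auto)

subsection \<open>The sampler\<close>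

text \<open>The event that more than \<open>m\<close> rounds are needed, including the case that the
  sampler never halts.\<close>

definition pending :: "nat \<Rightarrow> nat \<Rightarrow> ((int \<Rightarrow> bool) \<Rightarrow> bool) \<Rightarrow> nat \<Rightarrow> (int \<Rightarrow> bool) set" where
  "pending n L occ m = {R \<in> space fair_bits. \<forall>j\<in>{1..m}. occ (block (horizon n L) j R)}"

lemma pending_eq_bits:
  "pending n L occ m = {R \<in> space fair_bits.
     all_blocks (\<lambda>l. occ (list_block (horizon n L) l)) (horizon n L) m (bits (m * horizon n L) R)}"
  unfolding pending_def all_blocks_bits ..

lemma sets_pending [measurable]: "pending n L occ m \<in> sets fair_bits"
  unfolding pending_eq_bits by (rule measurable_bits_event)

lemma prob_pending:
  "measure fair_bits (pending n L occ m) =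
     measure_pmf.prob (Pi_pmf {1..int (horizon n L)} False (\<lambda>_. bernoulli_pmf (1/2))) {B. occ B} ^ m"
  unfolding pending_eq_bits prob_bits card_all_blocks prob_Pi_pmf_bits
  by (simp add: power_divide power_mult mult.commute[of m])

lemma not_halts_pending:
  assumes "R \<in> space fair_bits" "\<not> cftp_halts n L occ R"
  shows "R \<in> pending n L occ m"
  using assms by (auto simp: pending_def cftp_halts_def stops_at_def)

lemma stops_at_rounds:
  "cftp_halts n L occ R \<Longrightarrow> stops_at n L occ R (cftp_rounds n L occ R)"
  unfolding cftp_halts_def cftp_rounds_def by (rule LeastI_ex)

lemma pending_iff_less_rounds:
  assumes "R \<in> space fair_bits" "cftp_halts n L occ R"
  shows "R \<in> pending n L occ m \<longleftrightarrow> m < cftp_rounds n L occ R"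
proof -
  have "\<not> (\<forall>j\<in>{1..m}. occ (block (horizon n L) j R))" if "cftp_rounds n L occ R \<le> m"
    using stops_at_rounds[OF assms(2)] that by (auto simp: stops_at_def)
  moreover have "occ (block (horizon n L) j R)" if "m < cftp_rounds n L occ R" "j \<in> {1..m}" for j
    using not_less_Least[of j "stops_at n L occ R"] that by (auto simp: cftp_rounds_def stops_at_def)
  ultimately show ?thesis using assms(1) unfolding pending_def by (auto simp only: mem_Collect_eq not_le[symmetric])
qed

lemma measurable_rounds [measurable]: "cftp_rounds n L occ \<in> measurable fair_bits (count_space UNIV)"
proof -
  have stops: "{R \<in> space fair_bits. stops_at n L occ R j} \<in> sets fair_bits" for j
  proof (cases "1 \<le> j")
    case True
    then obtain k where "j = Suc k" by (cases j) auto
    hence "{R \<in> space fair_bits. stops_at n L occ R j} = {R \<in> space fair_bits.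
       \<not> occ (list_block (horizon n L) (take (horizon n L) (bits (Suc k * horizon n L) R)))}"
      by (simp add: stops_at_def block_eq_list_block)
    moreover have "\<dots> \<in> sets fair_bits" by (rule measurable_bits_event)
    ultimately show ?thesis by simp
  qed (simp add: stops_at_def)
  show ?thesis
    unfolding cftp_rounds_def[abs_def] using stops by measurable
qed

text \<open>Treats the bad event and the answer of the search at once: a rule must be strong enough
  that stopping forces coalescence and weak enough to fail at most half of the time.\<close>

locale cftp =
  fixes n L :: nat and Es :: "nat set list" and occ :: "(int \<Rightarrow> bool) \<Rightarrow> bool"
  assumes hg: "hypergraph n (set Es)" and L: "1 \<le> L"
    and coalescing: "\<And>B. \<not> occ B \<Longrightarrow> \<not> detect_answer n Es L B"
    and occ_half: "measure_pmf.prob (Pi_pmf {1..int (horizon n L)} False (\<lambda>_. bernoulli_pmf (1/2)))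
      {B. occ B} \<le> 1/2"
begin

sublocale fair: prob_space fair_bits by (rule prob_space_fair_bits)

lemma prob_pending_le: "fair.prob (pending n L occ m) \<le> (1/2) ^ m"
  unfolding prob_pending using occ_half by (intro power_mono) auto

text \<open>A sampler that never halts is pending after every number of rounds, and the intersection
  of these events has measure below every power of \<open>1/2\<close>.\<close>

lemma AE_halts: "AE R in fair_bits. cftp_halts n L occ R"
proof -
  define N where "N = (\<Inter>m. pending n L occ m)"
  have N: "N \<in> sets fair_bits" unfolding N_def by (intro sets.countable_INT) auto
  have "fair.prob N \<le> (1/2) ^ m" for m
    using fair.finite_measure_mono[of N "pending n L occ m"] prob_pending_le[of m]
    by (force simp: N_def)
  hence "fair.prob N = 0" using le_half_powers_imp_nonpos[of "fair.prob N"] by (simp add: antisym measure_nonneg)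
  hence "emeasure fair_bits N = 0" by (simp add: fair.emeasure_eq_measure)
  hence "N \<in> null_sets fair_bits" using N by blast
  moreover have "{R \<in> space fair_bits. \<not> cftp_halts n L occ R} \<subseteq> N"
    unfolding N_def using not_halts_pending by blast
  ultimately show ?thesis by (rule AE_I')
qed

text \<open>The tail-sum formula for the expectation, with the tails bounded by a geometric
  series.\<close>

lemma nn_integral_rounds: "(\<integral>\<^sup>+ R. of_nat (cftp_rounds n L occ R) \<partial>fair_bits) \<le> 2"
proof -
  have "AE R in fair_bits. of_nat (cftp_rounds n L occ R) = (\<Sum>m. indicator (pending n L occ m) R :: ennreal)"
    using AE_halts AE_space
  proof eventually_elim
    case (elim R)
    let ?J = "cftp_rounds n L occ R"
    have "(\<Sum>m. indicator (pending n L occ m) R :: ennreal) = (\<Sum>m\<in>{..<?J}. indicator (pending n L occ m) R)"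
      using pending_iff_less_rounds[OF elim(2,1)] by (intro suminf_finite) auto
    also have "\<dots> = (\<Sum>m\<in>{..<?J}. 1)"
      using pending_iff_less_rounds[OF elim(2,1)] by (intro sum.cong) auto
    finally show ?case by simp
  qed
  hence "(\<integral>\<^sup>+ R. of_nat (cftp_rounds n L occ R) \<partial>fair_bits) =
      (\<integral>\<^sup>+ R. (\<Sum>m. indicator (pending n L occ m) R) \<partial>fair_bits)"
    by (rule nn_integral_cong_AE)
  also have "\<dots> = (\<Sum>m. \<integral>\<^sup>+ R. indicator (pending n L occ m) R \<partial>fair_bits)"
    by (intro nn_integral_suminf) measurable
  also have "\<dots> = (\<Sum>m. emeasure fair_bits (pending n L occ m))" by simp
  also have "\<dots> \<le> (\<Sum>m. ennreal ((1/2) ^ m))"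
    using prob_pending_le by (intro suminf_le) (auto simp: fair.emeasure_eq_measure intro!: ennreal_leI)
  also have "\<dots> = ennreal (\<Sum>m. (1/2) ^ m)" by (intro suminf_ennreal2) auto
  also have "(\<Sum>m. (1/2) ^ m) = (2 :: real)" by (subst suminf_geometric) auto
  finally show ?thesis by simp
qed

text \<open>The \<open>m - j\<close> oldest rounds turn \<open>\<sigma>\<close> into some
  independent set. The block of round \<open>j\<close> sends every independent set to the same
  colouring, and the newer rounds then continue with the same bits.\<close>

lemma run_blocks_coalesced:
  assumes "1 \<le> j" "j \<le> m" "\<not> occ (block (horizon n L) j R)" "\<sigma> \<in> indep_sets n (set Es)"
  defines "T \<equiv> horizon n L"
  shows "run n (set Es) (\<lambda>i. R (int i - int (m * T))) (m * T) \<sigma> =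
     run n (set Es) (\<lambda>i. R (int i - int (j * T))) (j * T) (all_zero n)"
proof -
  have dvd: "n dvd k * T" for k by (simp add: T_def horizon_def)
  obtain k where j: "j = Suc k" using assms(1) by (cases j) auto
  obtain d where m: "m = d + j" using assms(2) by (metis le_iff_add add.commute)
  define \<rho> where "\<rho> = run n (set Es) (\<lambda>i. R (int i - int (m * T))) (d * T) \<sigma>"
  have \<rho>: "\<rho> \<in> indep_sets n (set Es)" unfolding \<rho>_def by (rule run_indep[OF assms(4)])
  have "run n (set Es) (\<lambda>i. R (int i - int (m * T))) (d * T + j * T) \<sigma> =
     run n (set Es) (\<lambda>i. R (int (d * T + i) - int (m * T))) (j * T) \<rho>"
    unfolding \<rho>_def by (rule run_add[OF dvd])
  also have "(\<lambda>i. R (int (d * T + i) - int (m * T))) = (\<lambda>i. R (int i - int (j * T)))"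
    by (simp add: m algebra_simps)
  finally have 1: "run n (set Es) (\<lambda>i. R (int i - int (m * T))) (m * T) \<sigma> =
     run n (set Es) (\<lambda>i. R (int i - int (j * T))) (j * T) \<rho>" by (simp add: m algebra_simps)
  \<comment> \<open>Splits off the oldest of the \<open>j\<close> rounds, the one in which
    coalescence takes place.\<close>
  have 2: "run n (set Es) (\<lambda>i. R (int i - int (j * T))) (j * T) \<tau> =
     run n (set Es) (\<lambda>i. R (int (T + i) - int (j * T))) (k * T)
       (run n (set Es) (\<lambda>i. block T j R (int i)) T \<tau>)" for \<tau>
  proof -
    have "run n (set Es) (\<lambda>i. R (int i - int (j * T))) (T + k * T) \<tau> =
       run n (set Es) (\<lambda>i. R (int (T + i) - int (j * T))) (k * T)
         (run n (set Es) (\<lambda>i. R (int i - int (j * T))) T \<tau>)"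
      using run_add[OF dvd[of 1], of "set Es" "\<lambda>i. R (int i - int (j * T))" "k * T" \<tau>] by simp
    moreover have "run n (set Es) (\<lambda>i. R (int i - int (j * T))) T \<tau> =
        run n (set Es) (\<lambda>i. block T j R (int i)) T \<tau>"
      by (rule run_cong) (auto simp: block_def)
    ultimately show ?thesis by (simp add: j)
  qed
  have "run n (set Es) (\<lambda>i. block T j R (int i)) T \<rho> = run n (set Es) (\<lambda>i. block T j R (int i)) T (all_zero n)"
    unfolding T_def using assms(3)
    by (intro coalescence hg L coalescing \<rho> all_zero_indep)
  thus ?thesis unfolding 1 by (subst (1 2) 2) simp
qed

text \<open>Once the sampler has stopped, starting further in the past, from any independent set,
  does not alter its output.\<close>

lemma output_eq_run:
  assumes "R \<in> space fair_bits" "R \<notin> pending n L occ m" "\<sigma> \<in> indep_sets n (set Es)"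
  shows "cftp_output n (set Es) L occ R =
     run n (set Es) (\<lambda>i. R (int i - int (m * horizon n L))) (m * horizon n L) \<sigma>"
proof -
  have halts: "cftp_halts n L occ R" using not_halts_pending assms by blast
  have "cftp_rounds n L occ R \<le> m"
    using pending_iff_less_rounds[OF assms(1) halts, of m] assms(2) by simp
  moreover have "stops_at n L occ R (cftp_rounds n L occ R)" by (rule stops_at_rounds[OF halts])
  ultimately show ?thesis
    unfolding cftp_output_def Let_def
    by (subst run_blocks_coalesced[of "cftp_rounds n L occ R" m]) (auto simp: stops_at_def assms(3))
qed

lemma run_eq_bits:
  "run n CC (\<lambda>i. R (int i - int m)) m \<sigma> = run n CC (\<lambda>i. bits m R ! (i - 1)) m \<sigma>"
  by (rule run_cong) (simp add: nth_bits)

lemma measurable_output: "cftp_output n (set Es) L occ \<in> measurable fair_bits (count_space UNIV)"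
proof -
  have run: "(\<lambda>R. run n (set Es) (\<lambda>i. R (int i - int m)) m \<sigma>) \<in> measurable fair_bits (count_space UNIV)" for m \<sigma>
    unfolding run_eq_bits
    by (rule measurable_compose[OF measurable_bits, where g = "\<lambda>l. run n (set Es) (\<lambda>i. l ! (i - 1)) m \<sigma>"]) simp
  show ?thesis
    unfolding cftp_output_def[abs_def] Let_def
    by (rule measurable_compose_countable[OF run measurable_rounds])
qed

text \<open>A uniform start is realised by averaging over all starts \<open>\<sigma>\<close>,
  without further randomness: the average over \<open>\<sigma>\<close> of the probability of
  \<open>Y m \<sigma>\<close> is exact for every \<open>m\<close>, while each of these probabilities
  tends to that of \<open>X\<close>.\<close>

lemma prob_output:
  "fair.prob {R \<in> space fair_bits. cftp_output n (set Es) L occ R \<in> A} =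
     card (A \<inter> indep_sets n (set Es)) / card (indep_sets n (set Es))"
proof -
  let ?O = "indep_sets n (set Es)" and ?T = "horizon n L"
  define X where "X = {R \<in> space fair_bits. cftp_output n (set Es) L occ R \<in> A}"
  define Y where "Y = (\<lambda>m \<sigma>. {R \<in> space fair_bits.
      run n (set Es) (\<lambda>i. bits (m * ?T) R ! (i - 1)) (m * ?T) \<sigma> \<in> A})"
  have n: "0 < n" using hg by (simp add: hypergraph_def)
  have "?O \<noteq> {}" using all_zero_indep[OF hg] by auto
  hence O: "0 < card ?O" using finite_indep_sets card_gt_0_iff by blast
  have X: "X \<in> sets fair_bits"
    using measurable_sets[OF measurable_output, of A] by (simp add: X_def vimage_def Collect_conj_eq Int_commute)
  have Y: "Y m \<sigma> \<in> sets fair_bits" for m \<sigma> unfolding Y_def by (rule measurable_bits_event)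
  have close: "\<bar>fair.prob X - fair.prob (Y m \<sigma>)\<bar> \<le> (1/2) ^ m" if "\<sigma> \<in> ?O" for m \<sigma>
  proof -
    \<comment> \<open>The output and the run from \<open>\<sigma>\<close> can differ only while the
      sampler is pending after \<open>m\<close> rounds.\<close>
    have "R \<in> X \<longleftrightarrow> R \<in> Y m \<sigma>" if "R \<in> space fair_bits" "R \<notin> pending n L occ m" for R
      using output_eq_run[OF that \<open>\<sigma> \<in> ?O\<close>] that unfolding X_def Y_def run_eq_bits by simp
    hence "X \<subseteq> Y m \<sigma> \<union> pending n L occ m" "Y m \<sigma> \<subseteq> X \<union> pending n L occ m"
      by (auto simp: X_def Y_def)
    hence "fair.prob X \<le> fair.prob (Y m \<sigma> \<union> pending n L occ m)" "fair.prob (Y m \<sigma>) \<le> fair.prob (X \<union> pending n L occ m)"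
      using X Y by (auto intro!: fair.finite_measure_mono)
    moreover have "fair.prob (Y m \<sigma> \<union> pending n L occ m) \<le> fair.prob (Y m \<sigma>) + fair.prob (pending n L occ m)"
      "fair.prob (X \<union> pending n L occ m) \<le> fair.prob X + fair.prob (pending n L occ m)"
      using X Y by (auto intro!: measure_Un_le)
    ultimately show ?thesis using prob_pending_le[of m] by linarith
  qed
  have sum: "(\<Sum>\<sigma>\<in>?O. fair.prob (Y m \<sigma>)) = card (A \<inter> ?O)" for m
  proof -
    have "fair.prob (Y m \<sigma>) =
        real (card {l. length l = m * ?T \<and> run n (set Es) (\<lambda>i. l ! (i - 1)) (m * ?T) \<sigma> \<in> A}) / 2 ^ (m * ?T)" for \<sigma>
      unfolding Y_def by (rule prob_bits[where P = "\<lambda>l. run n (set Es) (\<lambda>i. l ! (i - 1)) (m * ?T) \<sigma> \<in> A"])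
    hence "(\<Sum>\<sigma>\<in>?O. fair.prob (Y m \<sigma>)) =
        real (\<Sum>\<sigma>\<in>?O. card {l. length l = m * ?T \<and> run n (set Es) (\<lambda>i. l ! (i - 1)) (m * ?T) \<sigma> \<in> A}) / 2 ^ (m * ?T)"
      by (simp add: sum_divide_distrib)
    thus ?thesis unfolding run_stationary[OF n] by simp
  qed
  have "\<bar>fair.prob X - card (A \<inter> ?O) / card ?O\<bar> \<le> (1/2) ^ m" for m
  proof -
    have "card ?O * fair.prob X - card (A \<inter> ?O) = (\<Sum>\<sigma>\<in>?O. fair.prob X - fair.prob (Y m \<sigma>))"
      by (simp add: sum_subtractf sum)
    hence "\<bar>card ?O * fair.prob X - card (A \<inter> ?O)\<bar> \<le> (\<Sum>\<sigma>\<in>?O. \<bar>fair.prob X - fair.prob (Y m \<sigma>)\<bar>)"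
      by simp
    also have "\<dots> \<le> (\<Sum>\<sigma>\<in>?O. (1/2) ^ m)" by (intro sum_mono close)
    finally have "\<bar>card ?O * fair.prob X - card (A \<inter> ?O)\<bar> \<le> card ?O * (1/2) ^ m" by simp
    moreover have "card ?O * fair.prob X - card (A \<inter> ?O) = card ?O * (fair.prob X - card (A \<inter> ?O) / card ?O)"
      using O by (simp add: field_simps)
    ultimately have "card ?O * \<bar>fair.prob X - card (A \<inter> ?O) / card ?O\<bar> \<le> card ?O * (1/2) ^ m"
      by (simp add: abs_mult)
    thus ?thesis using O by simp
  qed
  hence "\<bar>fair.prob X - card (A \<inter> ?O) / card ?O\<bar> \<le> 0" by (rule le_half_powers_imp_nonpos)
  thus ?thesis by (simp add: X_def)
qed

lemma distr_output:
  "distr fair_bits (count_space UNIV) (cftp_output n (set Es) L occ) =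
     measure_pmf (pmf_of_set (indep_sets n (set Es)))"
proof (rule measure_eqI)
  fix A :: "(nat \<Rightarrow> bool) set"
  let ?O = "indep_sets n (set Es)"
  have "?O \<noteq> {}" using all_zero_indep[OF hg] by auto
  have "emeasure (distr fair_bits (count_space UNIV) (cftp_output n (set Es) L occ)) A =
      ennreal (fair.prob {R \<in> space fair_bits. cftp_output n (set Es) L occ R \<in> A})"
    by (simp add: emeasure_distr measurable_output fair.emeasure_eq_measure vimage_def Collect_conj_eq Int_commute)
  also have "\<dots> = ennreal (measure_pmf.prob (pmf_of_set ?O) A)"
    unfolding prob_output using \<open>?O \<noteq> {}\<close> by (simp add: measure_pmf_of_set finite_indep_sets Int_commute)
  finally show "emeasure (distr fair_bits (count_space UNIV) (cftp_output n (set Es) L occ)) A =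
      emeasure (measure_pmf (pmf_of_set ?O)) A"
    by (simp add: measure_pmf.emeasure_eq_measure)
qed simp

lemma nn_integral_time:
  assumes "distinct Es"
  shows "(\<integral>\<^sup>+ R. cftp_time n Es L occ R \<partial>fair_bits) \<le> of_nat (44 * (L + 1) *
     ((\<Sum>C\<in>set Es. weight (set Es) C) + card ({1..n} - \<Union>(set Es))))"
proof -
  define D where "D = 22 * (L + 1) * ((\<Sum>C\<in>set Es. weight (set Es) C) + card ({1..n} - \<Union>(set Es)))"
  have "(\<integral>\<^sup>+ R. cftp_time n Es L occ R \<partial>fair_bits) \<le>
      (\<integral>\<^sup>+ R. of_nat D * of_nat (cftp_rounds n L occ R) \<partial>fair_bits)"
    using AE_halts
    by (intro nn_integral_mono_AE) (auto elim!: eventually_mono dest!: cftp_time_le[OF hg assms] simp: D_def)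
  also have "\<dots> = of_nat D * (\<integral>\<^sup>+ R. of_nat (cftp_rounds n L occ R) \<partial>fair_bits)"
    by (intro nn_integral_cmult measurable_compose[OF measurable_rounds]) simp
  also have "\<dots> \<le> of_nat D * 2" by (intro mult_left_mono nn_integral_rounds) simp
  also have "\<dots> = of_nat (D * 2)" by simp
  also have "D * 2 = 44 * (L + 1) * ((\<Sum>C\<in>set Es. weight (set Es) C) + card ({1..n} - \<Union>(set Es)))"
    by (simp add: D_def)
  finally show ?thesis .
qed

end

text \<open>The constant \<open>K\<close> depends on \<open>\<epsilon>\<close> and on the lower
  bound \<open>\<beta>\<^sub>0\<close> only. That bound keeps \<open>x\<close> away from 0, so that
  the number \<open>L + 1\<close> of scans per round is at most a constant times \<open>x\<close>.
  The size in the time bound also counts the vertices outside all hyperedges, for which bits are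
  drawn too.\<close>

theorem theorem3p5:
  fixes \<epsilon> \<beta>\<^sub>0 :: real
  assumes "0 < \<epsilon>" and "\<epsilon> < 1" and "1/2 < \<beta>\<^sub>0"
  shows "\<exists>K::real. \<forall>(n::nat) (CC::nat set set) (Es::nat set list) (\<beta>::real).
    hypergraph n CC \<and> distinct Es \<and> set Es = CC \<and> \<beta>\<^sub>0 \<le> \<beta> \<and>
    (\<forall>L\<ge>1. prob_bad n CC L \<le> \<beta> * (1 - \<epsilon>) ^ L) \<longrightarrow>
    (let x = ln (2 * \<beta>) / (- ln (1 - \<epsilon>)); L = nat \<lceil>x\<rceil> in
      \<forall>occ \<in> {bad_event n CC L, detect_answer n Es L}.
        (AE R in fair_bits. cftp_halts n L occ R) \<and>
        (\<integral>\<^sup>+ R. cftp_time n Es L occ R \<partial>fair_bits)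
          \<le> ennreal (K * (x * real ((\<Sum>C\<in>CC. \<Sum>C'\<in>{C'\<in>CC. C \<inter> C' \<noteq> {}}. card C' * card C)
                                    + card ({1..n} - \<Union>CC)))) \<and>
        distr fair_bits (count_space UNIV) (cftp_output n CC L occ)
          = measure_pmf (pmf_of_set (indep_sets n CC)))"
proof -
  define c where "c = - ln (1 - \<epsilon>)"
  define x\<^sub>0 where "x\<^sub>0 = ln (2 * \<beta>\<^sub>0) / c"
  have c: "0 < c" using assms by (simp add: c_def)
  have x0: "0 < x\<^sub>0" using assms c by (simp add: x\<^sub>0_def)
  show ?thesis
  \<comment> \<open>The 44 is the cost factor 22 of a round times the expected number 2 of rounds.
    The rest comes from \<open>L + 1\<close> \<le> \<open>x + 2\<close>, where 2 is at most
    \<open>(2 / x\<^sub>0) * x\<close>.\<close>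
  proof (intro exI[of _ "44 * (1 + 2 / x\<^sub>0)"] allI impI, elim conjE)
    fix n :: nat and CC :: "nat set set" and Es :: "nat set list" and \<beta> :: real
    assume hg: "hypergraph n CC" and dist: "distinct Es" and CC: "set Es = CC" and \<beta>: "\<beta>\<^sub>0 \<le> \<beta>"
      and bad: "\<forall>L\<ge>1. prob_bad n CC L \<le> \<beta> * (1 - \<epsilon>) ^ L"
    define x where "x = ln (2 * \<beta>) / c"
    define L where "L = nat \<lceil>x\<rceil>"
    define S where "S = (\<Sum>C\<in>CC. \<Sum>C'\<in>{C'\<in>CC. C \<inter> C' \<noteq> {}}. card C' * card C) + card ({1..n} - \<Union>CC)"
    have "x\<^sub>0 \<le> x" unfolding x_def x\<^sub>0_def using \<beta> assms c by (intro divide_right_mono) auto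
    hence x: "0 < x" using x0 by linarith
    have bounds: "1 \<le> L" "x \<le> real L" "real L \<le> x + 1" using x unfolding L_def by linarith+
    \<comment> \<open>The choice of \<open>L\<close> makes \<open>(1 - \<epsilon>) ^ L\<close> at
      most \<open>1 / (2 * \<beta>)\<close>.\<close>
    have half: "prob_bad n CC L \<le> 1/2"
    proof -
      have "(1 - \<epsilon>) ^ L = exp (- (c * real L))"
        using assms by (simp add: c_def exp_of_nat2_mult[symmetric] mult.commute exp_of_nat_mult[symmetric])
           (simp add: powr_def flip: powr_realpow)
      also have "\<dots> \<le> exp (- ln (2 * \<beta>))"
        using bounds(2) c by (simp add: x_def field_simps)
      also have "\<dots> = 1 / (2 * \<beta>)" using \<beta> assms by (simp add: exp_minus inverse_eq_divide)
      finally have "\<beta> * (1 - \<epsilon>) ^ L \<le> \<beta> * (1 / (2 * \<beta>))"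
        using \<beta> assms by (intro mult_left_mono) auto
      thus ?thesis using bad bounds(1) \<beta> assms by fastforce
    qed
    have "(AE R in fair_bits. cftp_halts n L occ R) \<and>
        (\<integral>\<^sup>+ R. cftp_time n Es L occ R \<partial>fair_bits) \<le> ennreal (44 * (1 + 2 / x\<^sub>0) * (x * real S)) \<and>
        distr fair_bits (count_space UNIV) (cftp_output n CC L occ)
          = measure_pmf (pmf_of_set (indep_sets n CC))"
      if occ: "occ \<in> {bad_event n CC L, detect_answer n Es L}" for occ
    proof -
      \<comment> \<open>Both rules lie between these two events: the lower one gives coalescence,
        the upper one the failure probability.\<close>
      have detect: "detect_answer n Es L B \<Longrightarrow> occ B" "occ B \<Longrightarrow> bad_event n CC L B" for B
        using detect_answer_imp_bad_event[of n Es L B] hg bounds(1) CC occ by auto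
      interpret cftp n L Es occ
      proof
        have "measure_pmf.prob (Pi_pmf {1..int (horizon n L)} False (\<lambda>_. bernoulli_pmf (1/2))) {B. occ B}
            \<le> prob_bad n CC L"
          unfolding prob_bad_def using detect(2) by (intro measure_pmf.finite_measure_mono) auto
        thus "measure_pmf.prob (Pi_pmf {1..int (horizon n L)} False (\<lambda>_. bernoulli_pmf (1/2))) {B. occ B} \<le> 1/2"
          using half by linarith
      qed (use hg CC bounds detect in auto)
      have "(\<integral>\<^sup>+ R. cftp_time n Es L occ R \<partial>fair_bits) \<le> of_nat (44 * (L + 1) * S)"
        using nn_integral_time[OF dist] unfolding weight_def meets_def CC S_def .
      also have "\<dots> = ennreal (44 * (real L + 1) * real S)"
        by (simp add: ennreal_of_nat_eq_real_of_nat)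
      also have "\<dots> \<le> ennreal (44 * ((1 + 2 / x\<^sub>0) * x) * real S)"
      proof (intro ennreal_leI mult_right_mono mult_left_mono)
        have "2 \<le> 2 / x\<^sub>0 * x" using \<open>x\<^sub>0 \<le> x\<close> x0 by (simp add: field_simps)
        thus "real L + 1 \<le> (1 + 2 / x\<^sub>0) * x" using bounds(3) by (simp add: algebra_simps)
      qed auto
      finally show ?thesis using AE_halts distr_output unfolding CC mult.assoc by blast
    qed
    thus "let x = ln (2 * \<beta>) / (- ln (1 - \<epsilon>)); L = nat \<lceil>x\<rceil> in
      \<forall>occ \<in> {bad_event n CC L, detect_answer n Es L}.
        (AE R in fair_bits. cftp_halts n L occ R) \<and>
        (\<integral>\<^sup>+ R. cftp_time n Es L occ R \<partial>fair_bits)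
          \<le> ennreal (44 * (1 + 2 / x\<^sub>0) * (x * real ((\<Sum>C\<in>CC. \<Sum>C'\<in>{C'\<in>CC. C \<inter> C' \<noteq> {}}. card C' * card C)
                                    + card ({1..n} - \<Union>CC)))) \<and>
        distr fair_bits (count_space UNIV) (cftp_output n CC L occ)
          = measure_pmf (pmf_of_set (indep_sets n CC))"
      unfolding Let_def S_def[symmetric] c_def[symmetric] x_def[symmetric] L_def[symmetric] by blast
  qed
qed

end
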